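(* Let $\pi\ge 1$ be a fixed integer, let $\mu$ be a fixed measure on $\mathbb{R}^\pi$, and suppose the natural parameter space $\Theta\subset\mathbb{R}^\pi$ of the exponential family of densities $\exp\{\theta^{\mathrm T}x-\beta(\theta)\}$ with respect to $\mu$ is open. Let $\Theta_0$ be a fixed compact subset of $\Theta$ and let $\delta>0$ be fixed. For each $n$ and $m_1,\ldots,m_n\in\Theta$, let $M$ be the $n\times\pi$ matrix with $i$th row $m_i^{\mathrm T}$, and under $M$ let $X_1,\ldots,X_n$ be independent $\mathbb{R}^\pi$-valued random vectors with $X_i$ having density $\exp\{m_i^{\mathrm T}x_i-\beta(m_i)\}$ with respect to $\mu$; let $X$ be the $n\times\pi$ matrix with $i$th row $X_i^{\mathrm T}$. Let $\mathcal{T}=\mathcal{T}_n$ be the family of all test functions $T(X)$ invariant under permutations of the index $i$ (i.e. of the rows of $X$). Then, as $n\to\infty$, $$\sup\{|\mathrm{E}_M(T)-\mathrm{E}_{\overline M}(T)| : T\in\mathcal{T},\ \|M-\overline M\|\le\delta,\ m_i\in\Theta_0\text{ for }i=1,\ldots,n\}\to 0 .$$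
   Context: $\overline m=\sum_{i=1}^n m_i/n$ and $\overline M$ is the $n\times\pi$ matrix all of whose rows are $\overline m^{\mathrm T}$; $\|M\|^2=\mathrm{tr}(M^{\mathrm T}M)$. $\mathrm{E}_M$ denotes expectation under $M$; under $\overline M$ the $X_i$ are i.i.d. with density $\exp\{\overline m^{\mathrm T}x-\beta(\overline m)\}$. The natural parameter space is the (convex) set of $\theta\in\mathbb{R}^\pi$ for which $\int e^{\theta^{\mathrm T}x}\mu(dx)<\infty$, and $\beta(\theta)$ is the logarithm of this integral. A test function is a measurable function of the data with values in $[0,1]$. *)

theory Defs
  imports "HOL-Probability.Probability"
begin

definition natural_parameter_space :: "(real^'p) measure \<Rightarrow> (real^'p) set" where
  "natural_parameter_space \<mu> = {\<theta>. (\<integral>\<^sup>+ x. ennreal (exp (\<theta> \<bullet> x)) \<partial>\<mu>) < \<infinity>}"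

definition log_partition :: "(real^'p) measure \<Rightarrow> real^'p \<Rightarrow> real" where
  "log_partition \<mu> \<theta> = ln (\<integral>x. exp (\<theta> \<bullet> x) \<partial>\<mu>)"

definition expfam :: "(real^'p) measure \<Rightarrow> real^'p \<Rightarrow> (real^'p) measure" where
  "expfam \<mu> \<theta> = density \<mu> (\<lambda>x. ennreal (exp (\<theta> \<bullet> x - log_partition \<mu> \<theta>)))"

text \<open>
  An \<open>n \<times> p\<close> matrix is represented by the family of its rows, a function
  \<open>nat \<Rightarrow> real^'p\<close> of which only the values on \<open>{..<n}\<close> are relevant. The law of the data
  (independent rows, row \<open>i\<close> with natural parameter \<open>m i\<close>) is a product measure, which lives on
  the functions that are \<open>undefined\<close> outside \<open>{..<n}\<close>.
\<close>

definition data_law :: "(real^'p) measure \<Rightarrow> nat \<Rightarrow> (nat \<Rightarrow> real^'p) \<Rightarrow> (nat \<Rightarrow> real^'p) measure" where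
  "data_law \<mu> n m = PiM {..<n} (\<lambda>i. expfam \<mu> (m i))"

definition row_mean :: "nat \<Rightarrow> (nat \<Rightarrow> real^'p) \<Rightarrow> real^'p" where
  "row_mean n m = (\<Sum>i<n. m i) /\<^sub>R real n"

definition mean_matrix :: "nat \<Rightarrow> (nat \<Rightarrow> real^'p) \<Rightarrow> nat \<Rightarrow> real^'p" where
  "mean_matrix n m = (\<lambda>i. row_mean n m)"

text \<open>\<open>gram n m\<close> is the matrix product of the transpose of \<open>m\<close> with \<open>m\<close>.\<close>

definition gram :: "nat \<Rightarrow> (nat \<Rightarrow> real^'p) \<Rightarrow> real^'p^'p" where
  "gram n m = (\<chi> j k. \<Sum>i<n. m i $ j * m i $ k)"

definition mat_norm :: "nat \<Rightarrow> (nat \<Rightarrow> real^'p) \<Rightarrow> real" where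
  "mat_norm n m = sqrt (trace (gram n m))"

definition invariant_tests :: "nat \<Rightarrow> ((nat \<Rightarrow> real^'p) \<Rightarrow> real) set" where
  "invariant_tests n = {T. T \<in> borel_measurable (PiM {..<n} (\<lambda>_. borel)) \<and>
     (\<forall>X \<in> space (PiM {..<n} (\<lambda>_. borel)). 0 \<le> T X \<and> T X \<le> 1) \<and>
     (\<forall>X \<in> space (PiM {..<n} (\<lambda>_. borel)). \<forall>\<sigma>. \<sigma> permutes {..<n} \<longrightarrow> T (X \<circ> \<sigma>) = T X)}"

lemma mat_norm_power2: "(mat_norm n m)\<^sup>2 = (\<Sum>i<n. (norm (m i))\<^sup>2)"
proof -
  have eq: "trace (gram n m) = (\<Sum>i<n. (norm (m i))\<^sup>2)"
    unfolding trace_def gram_def power2_norm_eq_inner inner_vec_def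
    by (simp add: sum.swap[of _ UNIV])
  then have "0 \<le> trace (gram n m)"
    by (simp add: sum_nonneg)
  with eq show ?thesis
    by (simp add: mat_norm_def)
qed

lemma prob_space_expfam:
  assumes sets: "sets \<mu> = sets borel"
    and \<theta>: "\<theta> \<in> natural_parameter_space \<mu>"
    and nz: "emeasure \<mu> (space \<mu>) \<noteq> 0"
  shows "prob_space (expfam \<mu> \<theta>)"
proof
  have meas [measurable]: "(\<lambda>x. exp (\<theta> \<bullet> x)) \<in> borel_measurable \<mu>"
    unfolding measurable_cong_sets[OF sets refl] by measurable
  define I where "I = (\<integral>x. exp (\<theta> \<bullet> x) \<partial>\<mu>)"
  have int: "integrable \<mu> (\<lambda>x. exp (\<theta> \<bullet> x))"
    using \<theta> by (intro integrableI_nonneg) (auto simp: natural_parameter_space_def)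
  have nn: "(\<integral>\<^sup>+x. ennreal (exp (\<theta> \<bullet> x)) \<partial>\<mu>) = ennreal I"
    unfolding I_def by (rule nn_integral_eq_integral[OF int]) simp
  have "(\<integral>\<^sup>+x. ennreal (exp (\<theta> \<bullet> x)) \<partial>\<mu>) \<noteq> 0"
  proof
    assume "(\<integral>\<^sup>+x. ennreal (exp (\<theta> \<bullet> x)) \<partial>\<mu>) = 0"
    then have "AE x in \<mu>. False"
      by (simp add: nn_integral_0_iff_AE)
    with nz show False
      by (simp add: AE_iff_null null_sets_def)
  qed
  then have I: "I > 0"
    using nn by (simp add: ennreal_eq_0_iff)
  have "emeasure (expfam \<mu> \<theta>) (space (expfam \<mu> \<theta>))
      = (\<integral>\<^sup>+x. ennreal (exp (\<theta> \<bullet> x - ln I)) \<partial>\<mu>)"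
    using meas by (simp add: expfam_def log_partition_def I_def emeasure_density exp_diff
        cong: nn_integral_cong)
  also have "\<dots> = (\<integral>\<^sup>+x. ennreal (exp (\<theta> \<bullet> x)) * ennreal (1 / I) \<partial>\<mu>)"
    using I by (simp add: exp_diff flip: ennreal_mult)
  also have "\<dots> = ennreal I * ennreal (1 / I)"
    by (simp add: nn_integral_multc nn)
  also have "\<dots> = 1"
    using I by (simp flip: ennreal_mult)
  finally show "emeasure (expfam \<mu> \<theta>) (space (expfam \<mu> \<theta>)) = 1" .
qed

end

theory Submission
  imports Defs
begin

text \<open>
  An invariant test sees a law on the data only through its symmetrization. So the claim is that the
  average \<open>L\<close> of the likelihood ratio \<open>\<Prod>i<n. (dP\<^sub>i / dQ) (X (\<sigma> i))\<close> over all permutations \<open>\<sigma>\<close> is close to 1 in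
  mean under the i.i.d. law of \<open>Q\<close>, the member of the family at the mean parameter \<open>q\<close>; here \<open>P\<^sub>i\<close> is the law
  of row \<open>i\<close>. The distance is measured in \<open>L\<^sup>2\<close>.

  Write the \<open>i\<close>th ratio as \<open>1 + u i\<close>. The second moment of \<open>L\<close> is the average over \<open>\<sigma>\<close> of the products
  \<open>\<Prod>i<n. (1 + \<langle>u i, u (\<sigma> i)\<rangle>)\<close>, hence at most the average of \<open>exp (Y \<sigma>)\<close> with
  \<open>Y \<sigma> = (\<Sum>i<n. \<langle>u i, u (\<sigma> i)\<rangle>)\<close>. By Cauchy--Schwarz \<open>Y\<close> is at most \<open>\<Sum>i<n. \<parallel>u i\<parallel>\<^sup>2\<close>, which is of order
  \<open>\<parallel>M - mean matrix\<parallel>\<^sup>2 \<le> \<delta>\<^sup>2\<close>. The second moment of \<open>Y\<close> under a uniformly random permutation is of order \<open>1 / n\<close> as soon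
  as \<open>\<parallel>\<Sum>i<n. u i\<parallel>\<close> stays bounded as well (\<open>permutation_statistic_second_moment\<close>). This holds because the
  linear part of \<open>u i\<close> in \<open>m i - q\<close> cancels in the sum, and the remainders are of order
  \<open>(norm (m i - q))\<^sup>2\<close>. Thus \<open>exp (Y \<sigma>)\<close> averages to \<open>1 + o(1)\<close>; this is
  \<open>permutation_product_average\<close> and \<open>invariant_test_product_lower_bound\<close>.

  The ratios themselves may fail to be square integrable, since a few rows can be far from the mean. They
  are therefore cut to 0 where their logarithm \<open>l i\<close> exceeds a level \<open>B\<close> in modulus. The total mass lost is of order
  \<open>\<delta>\<^sup>2 / B\<^sup>2\<close>, uniformly in \<open>n\<close>, by Chebyshev's inequality. Cutting only decreases the ratio, so it yields a
  lower bound for the expectation of a test (\<open>product_likelihood_test_lower_bound\<close>); applied to \<open>T\<close> and to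
  \<open>1 - T\<close> it gives both inequalities.

  After the truncation all estimates reduce to \<open>\<bar>l i x\<bar> \<le> norm (m i - q) * C * (norm x + 1)\<close> and to a bound on the
  fourth moments of \<open>norm x + 1\<close> that is uniform over the convex hull of \<open>\<Theta>\<^sub>0\<close>, a compact subset of the open convex
  parameter space (\<open>moment_uniformly_bounded\<close>). Derivatives of the log-partition function are avoided:
  its Lipschitz bound is Jensen's inequality, and the means of the \<open>l i\<close> are read off from the total mass of
  the truncated ratios.
\<close>

section \<open>Second moments of permutation statistics\<close>

lemma sum_permutes_apply:
  fixes g :: "'a \<Rightarrow> real"
  assumes "finite S" "i \<in> S"
  shows "(\<Sum>\<sigma> | \<sigma> permutes S. g (\<sigma> i)) = fact (card S - 1) * (\<Sum>j\<in>S. g j)"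
proof -
  define R where "R = S - {i}"
  have R: "finite R" "i \<notin> R" "insert i R = S" "card R = card S - 1"
    using assms by (auto simp: R_def)
  have "(\<Sum>\<sigma> | \<sigma> permutes insert i R. g (\<sigma> i))
      = (\<Sum>b\<in>insert i R. \<Sum>q | q permutes R. g ((Transposition.transpose i b \<circ> q) i))"
    by (rule sum_over_permutations_insert[OF R(1,2)])
  also have "\<dots> = (\<Sum>b\<in>insert i R. \<Sum>q | q permutes R. g b)"
  proof (intro sum.cong refl)
    fix b q assume "q \<in> {q. q permutes R}"
    then have "q i = i"
      using R(2) by (auto simp: permutes_not_in)
    then show "g ((Transposition.transpose i b \<circ> q) i) = g b"
      by simp
  qed
  also have "\<dots> = (\<Sum>b\<in>S. fact (card S - 1) * g b)"
    using card_permutations[OF R(4) R(1)] by (simp add: R(3))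
  finally show ?thesis
    by (simp add: R(3) sum_distrib_left)
qed

lemma sum_permutes_apply2:
  fixes g :: "'a \<Rightarrow> 'a \<Rightarrow> real"
  assumes "finite S" "i \<in> S" "k \<in> S" "i \<noteq> k"
  shows "(\<Sum>\<sigma> | \<sigma> permutes S. g (\<sigma> i) (\<sigma> k)) = fact (card S - 2) * (\<Sum>j\<in>S. \<Sum>l\<in>S - {j}. g j l)"
proof -
  define R where "R = S - {i}"
  have R: "finite R" "i \<notin> R" "insert i R = S" "card R = card S - 1" "k \<in> R"
    using assms by (auto simp: R_def)
  have "(\<Sum>\<sigma> | \<sigma> permutes insert i R. g (\<sigma> i) (\<sigma> k))
      = (\<Sum>b\<in>insert i R. \<Sum>q | q permutes R. g ((Transposition.transpose i b \<circ> q) i) ((Transposition.transpose i b \<circ> q) k))"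
    by (rule sum_over_permutations_insert[OF R(1,2)])
  also have "\<dots> = (\<Sum>b\<in>insert i R. \<Sum>q | q permutes R. g b (Transposition.transpose i b (q k)))"
  proof (intro sum.cong refl)
    fix b q assume "q \<in> {q. q permutes R}"
    then have "q i = i"
      using R(2) by (auto simp: permutes_not_in)
    then show "g ((Transposition.transpose i b \<circ> q) i) ((Transposition.transpose i b \<circ> q) k) = g b (Transposition.transpose i b (q k))"
      by simp
  qed
  also have "\<dots> = (\<Sum>b\<in>insert i R. fact (card R - 1) * (\<Sum>l\<in>R. g b (Transposition.transpose i b l)))"
    by (intro sum.cong refl sum_permutes_apply R(1,5))
  also have "\<dots> = (\<Sum>b\<in>S. fact (card S - 2) * (\<Sum>l\<in>S - {b}. g b l))"
  proof (rule sum.cong)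
    fix b assume b: "b \<in> S"
    have "(\<Sum>l\<in>R. g b (Transposition.transpose i b l)) = (\<Sum>l\<in>S - {b}. g b l)"
    proof (rule sum.reindex_bij_witness[of _ "Transposition.transpose i b" "Transposition.transpose i b"])
      fix l assume "l \<in> R"
      then show "Transposition.transpose i b l \<in> S - {b}"
        using b R assms(2) by (auto simp: Transposition.transpose_def)
    next
      fix l assume "l \<in> S - {b}"
      then show "Transposition.transpose i b l \<in> R"
        using b R assms(2) by (auto simp: Transposition.transpose_def R_def)
    qed auto
    then show "fact (card R - 1) * (\<Sum>l\<in>R. g b (Transposition.transpose i b l))
        = fact (card S - 2) * (\<Sum>l\<in>S - {b}. g b l)"
      by (simp add: R(4) numeral_2_eq_2)
  qed (rule R(3))
  finally show ?thesis
    by (simp add: R(3) sum_distrib_left)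
qed

text \<open>
  Inclusion and exclusion over the constraints \<open>k \<noteq> i\<close> and \<open>l \<noteq> j\<close>: the squared total, minus the sums of
  squared row sums and of squared column sums, plus the sum of squared entries. The two negative
  terms are discarded.
\<close>

lemma sum_off_diagonal_products:
  fixes A :: "'a \<Rightarrow> 'a \<Rightarrow> real"
  assumes "finite S"
  shows "(\<Sum>i\<in>S. \<Sum>k\<in>S - {i}. \<Sum>j\<in>S. \<Sum>l\<in>S - {j}. A i j * A k l)
      \<le> (\<Sum>i\<in>S. \<Sum>j\<in>S. A i j)\<^sup>2 + (\<Sum>i\<in>S. \<Sum>j\<in>S. (A i j)\<^sup>2)"
proof -
  let ?r = "\<lambda>i. \<Sum>j\<in>S. A i j" and ?c = "\<lambda>j. \<Sum>i\<in>S. A i j"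
  let ?W = "\<Sum>i\<in>S. ?r i"
  have rm: "(\<Sum>x\<in>S - {y}. f x) = (\<Sum>x\<in>S. f x) - f y" if "y \<in> S" for y and f :: "'a \<Rightarrow> real"
    using assms that by (simp add: sum_diff1)
  have inner: "(\<Sum>j\<in>S. \<Sum>l\<in>S - {j}. A i j * A k l) = ?r i * ?r k - (\<Sum>j\<in>S. A i j * A k j)" for i k
    by (simp add: rm sum_subtractf sum_product)
  have "(\<Sum>i\<in>S. \<Sum>k\<in>S - {i}. \<Sum>j\<in>S. \<Sum>l\<in>S - {j}. A i j * A k l)
      = (\<Sum>i\<in>S. (?r i * ?W - (\<Sum>j\<in>S. A i j * ?c j)) - ((?r i)\<^sup>2 - (\<Sum>j\<in>S. (A i j)\<^sup>2)))"
  proof (intro sum.cong refl)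
    fix i assume "i \<in> S"
    have "(\<Sum>k\<in>S. \<Sum>j\<in>S. A i j * A k j) = (\<Sum>j\<in>S. A i j * ?c j)"
      by (subst sum.swap) (simp add: sum_distrib_left)
    then show "(\<Sum>k\<in>S - {i}. \<Sum>j\<in>S. \<Sum>l\<in>S - {j}. A i j * A k l)
      = (?r i * ?W - (\<Sum>j\<in>S. A i j * ?c j)) - ((?r i)\<^sup>2 - (\<Sum>j\<in>S. (A i j)\<^sup>2))"
      unfolding inner rm[OF \<open>i \<in> S\<close>]
      by (simp only: sum_subtractf sum_distrib_left[symmetric] power2_eq_square)
  qed
  also have "\<dots> = ?W\<^sup>2 - (\<Sum>j\<in>S. (?c j)\<^sup>2) - (\<Sum>i\<in>S. (?r i)\<^sup>2) + (\<Sum>i\<in>S. \<Sum>j\<in>S. (A i j)\<^sup>2)"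
  proof -
    have "(\<Sum>i\<in>S. \<Sum>j\<in>S. A i j * ?c j) = (\<Sum>j\<in>S. (?c j)\<^sup>2)"
      by (subst sum.swap) (simp add: sum_distrib_right power2_eq_square)
    then show ?thesis
      by (simp add: sum_subtractf sum_distrib_right[symmetric] power2_eq_square)
  qed
  also have "\<dots> \<le> ?W\<^sup>2 + (\<Sum>i\<in>S. \<Sum>j\<in>S. (A i j)\<^sup>2)"
    using sum_nonneg[of S "\<lambda>j. (?c j)\<^sup>2"] sum_nonneg[of S "\<lambda>i. (?r i)\<^sup>2"] by simp
  finally show ?thesis .
qed

text \<open>
  Under a uniformly random permutation, \<open>\<sigma> i\<close> is uniform, and for \<open>i \<noteq> k\<close> the pair \<open>(\<sigma> i, \<sigma> k)\<close> is
  uniform on the pairs of distinct elements. So after expansion of the square the second moment of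
  \<open>\<Sum>i\<in>S. A i (\<sigma> i)\<close> is an average over such pairs. What matters later is the factor \<open>1 / (card S - 1)\<close>:
  the statistic is small once the Frobenius norm and the total of \<open>A\<close> stay bounded.
\<close>

lemma permutation_statistic_second_moment:
  fixes A :: "'a \<Rightarrow> 'a \<Rightarrow> real"
  assumes "finite S" "card S \<ge> 2"
  shows "(\<Sum>\<sigma> | \<sigma> permutes S. (\<Sum>i\<in>S. A i (\<sigma> i))\<^sup>2)
      \<le> fact (card S) * ((2 * (\<Sum>i\<in>S. \<Sum>j\<in>S. (A i j)\<^sup>2) + (\<Sum>i\<in>S. \<Sum>j\<in>S. A i j)\<^sup>2) / (card S - 1))"
proof -
  define F where "F = (\<Sum>i\<in>S. \<Sum>j\<in>S. (A i j)\<^sup>2)"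
  define W where "W = (\<Sum>i\<in>S. \<Sum>j\<in>S. A i j)"
  define N where "N = card S"
  have N: "N \<ge> 2" using assms(2) by (simp add: N_def)
  have F: "0 \<le> F" by (simp add: F_def sum_nonneg)
  have split: "(\<Sum>i\<in>S. f i)\<^sup>2 = (\<Sum>i\<in>S. (f i)\<^sup>2 + (\<Sum>k\<in>S - {i}. f i * f k))" for f :: "'a \<Rightarrow> real"
  proof -
    have "(\<Sum>i\<in>S. f i)\<^sup>2 = (\<Sum>i\<in>S. \<Sum>k\<in>S. f i * f k)"
      by (simp add: power2_eq_square sum_product)
    also have "\<dots> = (\<Sum>i\<in>S. (f i)\<^sup>2 + (\<Sum>k\<in>S - {i}. f i * f k))"
      by (intro sum.cong refl) (simp add: sum.remove[OF assms(1)] power2_eq_square)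
    finally show ?thesis .
  qed
  have "(\<Sum>\<sigma> | \<sigma> permutes S. (\<Sum>i\<in>S. A i (\<sigma> i))\<^sup>2)
      = (\<Sum>i\<in>S. (\<Sum>\<sigma> | \<sigma> permutes S. (A i (\<sigma> i))\<^sup>2)
          + (\<Sum>k\<in>S - {i}. \<Sum>\<sigma> | \<sigma> permutes S. A i (\<sigma> i) * A k (\<sigma> k)))"
    unfolding split
    by (subst sum.swap, intro sum.cong refl, simp add: sum.distrib, rule sum.swap)
  also have "\<dots> = (\<Sum>i\<in>S. fact (N - 1) * (\<Sum>j\<in>S. (A i j)\<^sup>2)
          + (\<Sum>k\<in>S - {i}. fact (N - 2) * (\<Sum>j\<in>S. \<Sum>l\<in>S - {j}. A i j * A k l)))"
  proof (intro sum.cong refl arg_cong2[where f="(+)"])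
    fix i k assume "i \<in> S" "k \<in> S - {i}"
    then show "(\<Sum>\<sigma> | \<sigma> permutes S. A i (\<sigma> i) * A k (\<sigma> k))
        = fact (N - 2) * (\<Sum>j\<in>S. \<Sum>l\<in>S - {j}. A i j * A k l)"
      unfolding N_def by (intro sum_permutes_apply2[OF assms(1), where g="\<lambda>x y. A i x * A k y"]) auto
  next
    fix i assume "i \<in> S"
    then show "(\<Sum>\<sigma> | \<sigma> permutes S. (A i (\<sigma> i))\<^sup>2) = fact (N - 1) * (\<Sum>j\<in>S. (A i j)\<^sup>2)"
      unfolding N_def by (rule sum_permutes_apply[OF assms(1), where g="\<lambda>x. (A i x)\<^sup>2"])
  qed
  also have "\<dots> = fact (N - 1) * F + fact (N - 2) * (\<Sum>i\<in>S. \<Sum>k\<in>S - {i}. \<Sum>j\<in>S. \<Sum>l\<in>S - {j}. A i j * A k l)"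
    by (simp add: sum.distrib sum_distrib_left F_def)
  also have "\<dots> \<le> fact (N - 1) * F + fact (N - 2) * (W\<^sup>2 + F)"
    unfolding W_def F_def by (intro add_left_mono mult_left_mono sum_off_diagonal_products assms) auto
  also have "\<dots> \<le> fact N * ((2 * F + W\<^sup>2) / (N - 1))"
  proof -
    obtain k where k: "N = Suc (Suc k)"
      using N by (metis add_2_eq_Suc le_Suc_ex)
    have "W\<^sup>2 + F + (real k + 1) * F \<le> (real k + 2) * (2 * F + W\<^sup>2)"
    proof -
      have "0 \<le> (real k + 1) * (F + W\<^sup>2) + F" using F by simp
      then show ?thesis by (simp add: algebra_simps)
    qed
    then have "fact k * (W\<^sup>2 + F + (real k + 1) * F) \<le> fact k * ((real k + 2) * (2 * F + W\<^sup>2))"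
      by (intro mult_left_mono) auto
    also have "\<dots> = fact N * ((2 * F + W\<^sup>2) / (N - 1))"
      by (simp add: k field_simps)
    finally show ?thesis
      by (simp add: k algebra_simps)
  qed
  finally show ?thesis
    by (simp add: F_def W_def N_def of_nat_diff)
qed

section \<open>Products of densities and permuted coordinates\<close>

text \<open>
  Both measures assign \<open>\<Prod>i\<in>I. \<integral>\<^sup>+x. f i x * indicator (A i) x \<partial>Q\<close> to a measurable box \<open>Pi\<^sub>E I A\<close>.
\<close>

lemma PiM_density:
  assumes I: "finite I" and Q: "prob_space Q"
    and f: "\<And>i. i \<in> I \<Longrightarrow> f i \<in> borel_measurable Q"
    and P: "\<And>i. i \<in> I \<Longrightarrow> prob_space (density Q (f i))"
  shows "PiM I (\<lambda>i. density Q (f i)) = density (PiM I (\<lambda>_. Q)) (\<lambda>X. \<Prod>i\<in>I. f i (X i))"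
proof -
  \<comment> \<open>The product measure theorems ask for probability measures at every index, so the family is
    extended by the constant density 1 outside \<open>I\<close>.\<close>
  define g where "g i = (if i \<in> I then f i else (\<lambda>_. 1))" for i
  have g [measurable]: "g i \<in> borel_measurable Q" for i
    using f by (auto simp: g_def)
  have Pg: "prob_space (density Q (g i))" for i
    using P Q by (auto simp: g_def density_1)
  interpret Q: product_prob_space "\<lambda>_. Q" I
    by (rule product_prob_spaceI) (rule Q)
  interpret P: product_prob_space "\<lambda>i. density Q (g i)" I
    by (rule product_prob_spaceI) (rule Pg)
  have "density (PiM I (\<lambda>_. Q)) (\<lambda>X. \<Prod>i\<in>I. g i (X i)) = PiM I (\<lambda>i. density Q (g i))"
  proof (rule P.PiM_eqI[OF I])
    show "sets (density (PiM I (\<lambda>_. Q)) (\<lambda>X. \<Prod>i\<in>I. g i (X i))) = sets (PiM I (\<lambda>i. density Q (g i)))"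
      by (simp cong: sets_PiM_cong)
    fix A assume "\<And>i. i \<in> I \<Longrightarrow> A i \<in> sets (density Q (g i))"
    then have A [measurable]: "i \<in> I \<Longrightarrow> A i \<in> sets Q" for i
      by simp
    have "emeasure (density (PiM I (\<lambda>_. Q)) (\<lambda>X. \<Prod>i\<in>I. g i (X i))) (Pi\<^sub>E I A)
        = (\<integral>\<^sup>+X. (\<Prod>i\<in>I. g i (X i)) * indicator (Pi\<^sub>E I A) X \<partial>PiM I (\<lambda>_. Q))"
      by (intro emeasure_density sets_PiM_I_finite I) (auto intro: A)
    also have "\<dots> = (\<integral>\<^sup>+X. (\<Prod>i\<in>I. g i (X i) * indicator (A i) (X i)) \<partial>PiM I (\<lambda>_. Q))"
    proof (intro nn_integral_cong)
      fix X assume "X \<in> space (PiM I (\<lambda>_. Q))"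
      then have "X \<in> extensional I" by (auto simp: space_PiM PiE_def)
      then have "indicator (Pi\<^sub>E I A) X = (\<Prod>i\<in>I. indicator (A i) (X i) :: ennreal)"
        using I by (auto simp: indicator_def PiE_def Pi_def prod_zero_iff)
      then show "(\<Prod>i\<in>I. g i (X i)) * indicator (Pi\<^sub>E I A) X = (\<Prod>i\<in>I. g i (X i) * indicator (A i) (X i))"
        by (simp add: prod.distrib)
    qed
    also have "\<dots> = (\<Prod>i\<in>I. \<integral>\<^sup>+x. g i x * indicator (A i) x \<partial>Q)"
      by (intro Q.product_nn_integral_prod I borel_measurable_times_ennreal g borel_measurable_indicator A)
    also have "\<dots> = (\<Prod>i\<in>I. emeasure (density Q (g i)) (A i))"
      by (intro prod.cong refl) (simp add: emeasure_density A)
    finally show "emeasure (density (PiM I (\<lambda>_. Q)) (\<lambda>X. \<Prod>i\<in>I. g i (X i))) (Pi\<^sub>E I A)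
        = (\<Prod>i\<in>I. emeasure (density Q (g i)) (A i))" .
  qed
  moreover have "PiM I (\<lambda>i. density Q (f i)) = PiM I (\<lambda>i. density Q (g i))"
    by (intro PiM_cong) (auto simp: g_def)
  ultimately show ?thesis
    by (simp add: g_def cong: prod.cong)
qed

lemma measurable_comp_permutes:
  assumes "\<sigma> permutes I"
  shows "(\<lambda>X. X \<circ> \<sigma>) \<in> measurable (PiM I (\<lambda>_. Q)) (PiM I (\<lambda>_. Q))"
proof (rule measurable_PiM_single')
  fix i assume "i \<in> I"
  then have "\<sigma> i \<in> I" using assms by (simp add: permutes_in_image)
  then show "(\<lambda>X. (X \<circ> \<sigma>) i) \<in> measurable (PiM I (\<lambda>_. Q)) Q"
    by simp
next
  show "(\<lambda>X. X \<circ> \<sigma>) \<in> space (PiM I (\<lambda>_. Q)) \<rightarrow> (\<Pi>\<^sub>E i\<in>I. space Q)"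
    using assms by (auto simp: space_PiM PiE_def Pi_def extensional_def permutes_in_image permutes_not_in)
qed

lemma distr_PiM_permutes:
  assumes I: "finite I" and Q: "prob_space Q" and \<sigma>: "\<sigma> permutes I"
  shows "distr (PiM I (\<lambda>_. Q)) (PiM I (\<lambda>_. Q)) (\<lambda>X. X \<circ> \<sigma>) = PiM I (\<lambda>_. Q)"
proof -
  interpret Q: product_prob_space "\<lambda>_. Q" I
    by (rule product_prob_spaceI) (rule Q)
  note inv = permutes_inverses[OF \<sigma>] permutes_in_image[OF permutes_inv[OF \<sigma>]] permutes_in_image[OF \<sigma>]
  show ?thesis
  proof (rule Q.PiM_eqI[OF I])
    fix A assume A: "\<And>i. i \<in> I \<Longrightarrow> A i \<in> sets Q"
    have "(\<lambda>X. X \<circ> \<sigma>) -` Pi\<^sub>E I A \<inter> space (PiM I (\<lambda>_. Q)) = (\<Pi>\<^sub>E i\<in>I. A (inv \<sigma> i))"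
    proof (intro set_eqI iffI)
      fix X assume "X \<in> (\<lambda>X. X \<circ> \<sigma>) -` Pi\<^sub>E I A \<inter> space (PiM I (\<lambda>_. Q))"
      then have X: "X \<in> extensional I" "\<And>i. i \<in> I \<Longrightarrow> X (\<sigma> i) \<in> A i"
        by (auto simp: space_PiM PiE_def)
      have "X i \<in> A (inv \<sigma> i)" if "i \<in> I" for i
        using X(2)[of "inv \<sigma> i"] that by (simp add: inv)
      then show "X \<in> (\<Pi>\<^sub>E i\<in>I. A (inv \<sigma> i))"
        using X(1) by (auto simp: PiE_def)
    next
      fix X assume "X \<in> (\<Pi>\<^sub>E i\<in>I. A (inv \<sigma> i))"
      then have X: "X \<in> extensional I" "\<And>i. i \<in> I \<Longrightarrow> X i \<in> A (inv \<sigma> i)"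
        by (auto simp: PiE_def)
      have *: "X (\<sigma> i) \<in> A i" if "i \<in> I" for i
        using X(2)[of "\<sigma> i"] that by (simp add: inv)
      moreover have "X i \<in> space Q" if "i \<in> I" for i
        using X(2)[OF that] A[of "inv \<sigma> i"] that sets.sets_into_space by (auto simp: inv)
      moreover have "X \<circ> \<sigma> \<in> extensional I"
        using X(1) \<sigma> by (auto simp: extensional_def permutes_not_in)
      ultimately show "X \<in> (\<lambda>X. X \<circ> \<sigma>) -` Pi\<^sub>E I A \<inter> space (PiM I (\<lambda>_. Q))"
        using X(1) by (auto simp: space_PiM PiE_def)
    qed
    then have "emeasure (distr (PiM I (\<lambda>_. Q)) (PiM I (\<lambda>_. Q)) (\<lambda>X. X \<circ> \<sigma>)) (Pi\<^sub>E I A)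
        = emeasure (PiM I (\<lambda>_. Q)) (\<Pi>\<^sub>E i\<in>I. A (inv \<sigma> i))"
      using A by (subst emeasure_distr) (auto intro!: measurable_comp_permutes \<sigma> sets_PiM_I_finite I)
    also have "\<dots> = (\<Prod>i\<in>I. emeasure Q (A (inv \<sigma> i)))"
      using A by (intro Q.emeasure_PiM I) (auto simp: inv)
    also have "\<dots> = (\<Prod>i\<in>I. emeasure Q (A i))"
      using permutes_imp_bij[OF permutes_inv[OF \<sigma>]] by (rule prod.reindex_bij_betw)
    finally show "emeasure (distr (PiM I (\<lambda>_. Q)) (PiM I (\<lambda>_. Q)) (\<lambda>X. X \<circ> \<sigma>)) (Pi\<^sub>E I A)
        = (\<Prod>i\<in>I. emeasure Q (A i))" .
  qed simp
qed

section \<open>Invariant tests against product weights\<close>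

lemma exp_le_one_plus_abs:
  fixes y s :: real
  assumes "y \<le> s" "0 \<le> s"
  shows "exp y \<le> 1 + \<bar>y\<bar> * exp s"
proof (cases "y \<le> 0")
  case True
  then have "exp y \<le> 1" by simp
  then show ?thesis by (smt (verit) mult_nonneg_nonneg exp_ge_zero abs_ge_zero)
next
  case False
  have "1 - y \<le> exp (- y)" using exp_ge_add_one_self[of "- y"] by simp
  then have "(1 - y) * exp y \<le> exp (- y) * exp y" by (intro mult_right_mono) auto
  then have "exp y \<le> 1 + y * exp y" by (simp add: algebra_simps flip: exp_add)
  also have "\<dots> \<le> 1 + y * exp s" using False assms by (intro add_left_mono mult_left_mono) auto
  finally show ?thesis using False by simp
qed

text \<open>
  The case of interest is \<open>A i j = \<langle>u i, u j\<rangle>\<close> and \<open>G i j = \<langle>1 + u i, 1 + u j\<rangle>\<close> in an \<open>L\<^sup>2\<close> space. The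
  product is at most \<open>exp (Y \<sigma>)\<close> with \<open>Y \<sigma> = (\<Sum>i\<in>I. A i (\<sigma> i))\<close>. By the Cauchy--Schwarz hypothesis
  \<open>Y\<close> is at most the trace bound \<open>s\<close>, which turns the exponential into the linear bound
  \<open>1 + \<bar>Y \<sigma>\<bar> * exp s\<close>, and the mean of \<open>\<bar>Y\<bar>\<close> is small because its second moment is.
\<close>

lemma permutation_product_average:
  fixes A G :: "'a \<Rightarrow> 'a \<Rightarrow> real"
  assumes I: "finite I" "card I \<ge> 2"
    and G: "\<And>i j. i \<in> I \<Longrightarrow> j \<in> I \<Longrightarrow> 0 \<le> G i j \<and> G i j \<le> 1 + A i j"
    and diag: "\<And>i. i \<in> I \<Longrightarrow> 0 \<le> A i i" "(\<Sum>i\<in>I. A i i) \<le> s"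
    and CS: "\<And>i j. i \<in> I \<Longrightarrow> j \<in> I \<Longrightarrow> (A i j)\<^sup>2 \<le> A i i * A j j"
    and V: "\<bar>\<Sum>i\<in>I. \<Sum>j\<in>I. A i j\<bar> \<le> v"
  shows "(\<Sum>\<sigma> | \<sigma> permutes I. \<Prod>i\<in>I. G i (\<sigma> i))
      \<le> fact (card I) * (1 + exp s * sqrt ((2 * s\<^sup>2 + v\<^sup>2) / (card I - 1)))"
proof -
  define Y where "Y \<sigma> = (\<Sum>i\<in>I. A i (\<sigma> i))" for \<sigma>
  define P where "P = {\<sigma>. \<sigma> permutes I}"
  define c where "c = (2 * s\<^sup>2 + v\<^sup>2) / (card I - 1)"
  have P: "finite P" "real (card P) = fact (card I)"
    using finite_permutations[OF I(1)] card_permutations[OF refl I(1)] by (auto simp: P_def)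
  have c: "0 \<le> c" by (simp add: c_def)
  have s: "0 \<le> s" using diag sum_nonneg[of I "\<lambda>i. A i i"] by fastforce
  have Y: "Y \<sigma> \<le> s" if "\<sigma> \<in> P" for \<sigma>
  proof -
    have \<sigma>: "\<sigma> permutes I" using that by (simp add: P_def)
    have "A i j \<le> (A i i + A j j) / 2" if "i \<in> I" "j \<in> I" for i j
    proof (rule power2_le_imp_le)
      have "(A i j)\<^sup>2 \<le> A i i * A j j" by (rule CS[OF that])
      also have "\<dots> \<le> ((A i i + A j j) / 2)\<^sup>2"
        using sum_squares_ge_zero[of "A i i - A j j" 0] by (simp add: power2_eq_square field_simps)
      finally show "(A i j)\<^sup>2 \<le> ((A i i + A j j) / 2)\<^sup>2" .
    qed (use diag(1) that in auto)
    then have "Y \<sigma> \<le> (\<Sum>i\<in>I. (A i i + A (\<sigma> i) (\<sigma> i)) / 2)"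
      unfolding Y_def using permutes_in_image[OF \<sigma>] by (intro sum_mono) auto
    also have "\<dots> = ((\<Sum>i\<in>I. A i i) + (\<Sum>i\<in>I. A (\<sigma> i) (\<sigma> i))) / 2"
      by (simp add: sum.distrib flip: sum_divide_distrib)
    also have "(\<Sum>i\<in>I. A (\<sigma> i) (\<sigma> i)) = (\<Sum>i\<in>I. A i i)"
      by (rule sum.reindex_bij_betw[OF permutes_imp_bij[OF \<sigma>]])
    finally show ?thesis using diag(2) by simp
  qed
  have sq: "(\<Sum>i\<in>I. \<Sum>j\<in>I. (A i j)\<^sup>2) \<le> s\<^sup>2"
  proof -
    have "(\<Sum>i\<in>I. \<Sum>j\<in>I. (A i j)\<^sup>2) \<le> (\<Sum>i\<in>I. \<Sum>j\<in>I. A i i * A j j)"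
      by (intro sum_mono CS)
    also have "\<dots> = (\<Sum>i\<in>I. A i i)\<^sup>2" by (simp add: sum_product power2_eq_square)
    also have "\<dots> \<le> s\<^sup>2" using diag by (intro power_mono sum_nonneg) auto
    finally show ?thesis .
  qed
  have "(\<Sum>\<sigma>\<in>P. (Y \<sigma>)\<^sup>2) \<le> fact (card I) *
      ((2 * (\<Sum>i\<in>I. \<Sum>j\<in>I. (A i j)\<^sup>2) + (\<Sum>i\<in>I. \<Sum>j\<in>I. A i j)\<^sup>2) / (card I - 1))"
    unfolding P_def Y_def by (rule permutation_statistic_second_moment[OF I])
  also have "\<dots> \<le> fact (card I) * c"
    unfolding c_def using sq abs_le_square_iff[THEN iffD1, of "\<Sum>i\<in>I. \<Sum>j\<in>I. A i j" v] V
    by (intro mult_left_mono divide_right_mono add_mono) auto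
  finally have Y2: "(\<Sum>\<sigma>\<in>P. (Y \<sigma>)\<^sup>2) \<le> fact (card I) * c" .
  have "(\<Sum>\<sigma>\<in>P. \<bar>Y \<sigma>\<bar>) \<le> fact (card I) * sqrt c"
  proof -
    have "(\<Sum>\<sigma>\<in>P. \<bar>Y \<sigma>\<bar>)\<^sup>2 \<le> (\<Sum>\<sigma>\<in>P. \<bar>Y \<sigma>\<bar>\<^sup>2) * card P"
      by (rule sum_squared_le_sum_of_squares)
    also have "\<dots> \<le> (fact (card I) * c) * fact (card I)"
      using Y2 P(2) by (intro mult_mono) (auto simp: c_def intro: sum_nonneg)
    also have "\<dots> = (fact (card I) * sqrt c)\<^sup>2"
      using c by (simp add: power_mult_distrib power2_eq_square)
    finally show ?thesis
      by (rule power2_le_imp_le) (auto simp: c_def)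
  qed
  have "(\<Sum>\<sigma>\<in>P. \<Prod>i\<in>I. G i (\<sigma> i)) \<le> (\<Sum>\<sigma>\<in>P. 1 + \<bar>Y \<sigma>\<bar> * exp s)"
  proof (rule sum_mono)
    fix \<sigma> assume "\<sigma> \<in> P"
    then have \<sigma>: "\<sigma> permutes I" by (simp add: P_def)
    have "(\<Prod>i\<in>I. G i (\<sigma> i)) \<le> (\<Prod>i\<in>I. exp (A i (\<sigma> i)))"
    proof (rule prod_mono)
      fix i assume "i \<in> I"
      then have "\<sigma> i \<in> I" using permutes_in_image[OF \<sigma>] by simp
      then show "0 \<le> G i (\<sigma> i) \<and> G i (\<sigma> i) \<le> exp (A i (\<sigma> i))"
        using G[OF \<open>i \<in> I\<close>, of "\<sigma> i"] exp_ge_add_one_self[of "A i (\<sigma> i)"] by linarith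
    qed
    also have "\<dots> = exp (Y \<sigma>)" by (simp add: Y_def exp_sum I(1))
    also have "\<dots> \<le> 1 + \<bar>Y \<sigma>\<bar> * exp s"
      by (rule exp_le_one_plus_abs[OF Y[OF \<open>\<sigma> \<in> P\<close>] s])
    finally show "(\<Prod>i\<in>I. G i (\<sigma> i)) \<le> 1 + \<bar>Y \<sigma>\<bar> * exp s" .
  qed
  also have "\<dots> = fact (card I) + (\<Sum>\<sigma>\<in>P. \<bar>Y \<sigma>\<bar>) * exp s"
    by (simp add: sum.distrib P(2) sum_distrib_right)
  also have "\<dots> \<le> fact (card I) + fact (card I) * sqrt c * exp s"
    using \<open>(\<Sum>\<sigma>\<in>P. \<bar>Y \<sigma>\<bar>) \<le> _\<close> by (intro add_left_mono mult_right_mono) auto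
  finally show ?thesis
    by (simp add: P_def c_def algebra_simps)
qed

lemma integral_Cauchy_Schwarz:
  fixes f g :: "'a \<Rightarrow> real"
  assumes [measurable]: "f \<in> borel_measurable M" "g \<in> borel_measurable M"
    and f: "integrable M (\<lambda>x. (f x)\<^sup>2)" and g: "integrable M (\<lambda>x. (g x)\<^sup>2)"
  shows "integrable M (\<lambda>x. f x * g x)"
    and "(\<integral>x. f x * g x \<partial>M)\<^sup>2 \<le> (\<integral>x. (f x)\<^sup>2 \<partial>M) * (\<integral>x. (g x)\<^sup>2 \<partial>M)"
proof -
  show fg: "integrable M (\<lambda>x. f x * g x)"
  proof (rule Bochner_Integration.integrable_bound)
    show "integrable M (\<lambda>x. (f x)\<^sup>2 + (g x)\<^sup>2)" using f g by simp
    have "\<bar>a * b\<bar> \<le> a\<^sup>2 + b\<^sup>2" for a b :: real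
    proof -
      have "0 \<le> \<bar>a * b\<bar>" "2 * \<bar>a * b\<bar> \<le> a\<^sup>2 + b\<^sup>2"
        using sum_squares_bound[of "\<bar>a\<bar>" "\<bar>b\<bar>"] by (simp_all add: abs_mult)
      then show ?thesis by linarith
    qed
    then show "AE x in M. norm (f x * g x) \<le> norm ((f x)\<^sup>2 + (g x)\<^sup>2)"
      by auto
  qed measurable
  define a b c where "a = (\<integral>x. (f x)\<^sup>2 \<partial>M)" and "b = (\<integral>x. (g x)\<^sup>2 \<partial>M)" and "c = (\<integral>x. f x * g x \<partial>M)"
  have quad: "0 \<le> p\<^sup>2 * a + 2 * p * q * c + q\<^sup>2 * b" for p q :: real
  proof -
    have "0 \<le> (\<integral>x. (p * f x + q * g x)\<^sup>2 \<partial>M)"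
      by (intro integral_nonneg_AE) auto
    also have "\<dots> = (\<integral>x. p\<^sup>2 * (f x)\<^sup>2 + 2 * p * q * (f x * g x) + q\<^sup>2 * (g x)\<^sup>2 \<partial>M)"
      by (intro Bochner_Integration.integral_cong) (auto simp: power2_eq_square algebra_simps)
    also have "\<dots> = p\<^sup>2 * a + 2 * p * q * c + q\<^sup>2 * b"
      using f g fg by (simp add: a_def b_def c_def)
    finally show ?thesis .
  qed
  have nn: "0 \<le> a" "0 \<le> b" by (simp_all add: a_def b_def)
  \<comment> \<open>Either of \<open>a\<close> and \<open>b\<close> may vanish, so the quadratic form is used at two points.\<close>
  have "0 \<le> b * (a * b - c\<^sup>2)" "0 \<le> a * (a * b - c\<^sup>2)"
    using quad[of b "- c"] quad[of "- c" a] by (simp_all add: power2_eq_square algebra_simps)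
  then have "c\<^sup>2 \<le> a * b"
  proof (cases "a = 0 \<and> b = 0")
    case True
    then have "c = 0" using quad[of 1 1] quad[of 1 "-1"] by simp
    then show ?thesis using nn by simp
  qed (use nn in \<open>auto simp: zero_le_mult_iff\<close>)
  then show "(\<integral>x. f x * g x \<partial>M)\<^sup>2 \<le> (\<integral>x. (f x)\<^sup>2 \<partial>M) * (\<integral>x. (g x)\<^sup>2 \<partial>M)"
    by (simp add: a_def b_def c_def)
qed

lemma one_minus_sum_le_prod:
  fixes c :: "'a \<Rightarrow> real"
  assumes "finite I" "\<And>i. i \<in> I \<Longrightarrow> 0 \<le> c i \<and> c i \<le> 1"
  shows "1 - (\<Sum>i\<in>I. 1 - c i) \<le> (\<Prod>i\<in>I. c i)"
  using assms
proof (induction I)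
  case (insert i I)
  have "(\<Prod>i\<in>I. c i) \<le> 1" using insert.prems by (intro prod_le_1) auto
  then have "(1 - c i) * (\<Prod>i\<in>I. c i) \<le> 1 - c i"
    using insert.prems[of i] by (intro mult_left_le) auto
  then show ?case using insert by (simp add: algebra_simps)
qed simp

text \<open>
  An invariant \<open>T\<close> does not distinguish the product weight \<open>\<Prod>i\<in>I. h i (X i)\<close> from its average \<open>L X\<close> over
  all permutations of the factors, so it is enough to bound the second moment of \<open>L - 1\<close> under the
  i.i.d. law. By independence that of \<open>L\<close> is the average over \<open>\<sigma>\<close> of \<open>\<Prod>i\<in>I. \<langle>h i, h (\<sigma> i)\<rangle>\<close>, which
  \<open>permutation_product_average\<close> controls: an inner product is at most
  \<open>1 + \<langle>h i - 1, h j - 1\<rangle>\<close> because the means are at most 1, the trace of the matrix \<open>\<langle>h i - 1, h j - 1\<rangle>\<close> is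
  \<open>\<Sum>i\<in>I. \<parallel>h i - 1\<parallel>\<^sup>2\<close> and the sum of all its entries is \<open>\<parallel>\<Sum>i\<in>I. h i - 1\<parallel>\<^sup>2\<close>. The mean of \<open>L\<close> falls
  short of 1 by at most the total mass \<open>\<rho>\<close> missing from the weights.
\<close>

lemma invariant_test_product_lower_bound:
  fixes h :: "'i \<Rightarrow> 'a \<Rightarrow> real" and T :: "('i \<Rightarrow> 'a) \<Rightarrow> real"
  assumes Q: "prob_space Q" and I: "finite I" "card I \<ge> 2"
    and h: "\<And>i. i \<in> I \<Longrightarrow> h i \<in> borel_measurable Q" "\<And>i x. i \<in> I \<Longrightarrow> 0 \<le> h i x"
      "\<And>i. i \<in> I \<Longrightarrow> integrable Q (\<lambda>x. (h i x)\<^sup>2)"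
      "\<And>i. i \<in> I \<Longrightarrow> (\<integral>x. h i x \<partial>Q) \<le> 1"
    and \<rho>: "(\<Sum>i\<in>I. 1 - (\<integral>x. h i x \<partial>Q)) \<le> \<rho>"
    and s: "(\<Sum>i\<in>I. \<integral>x. (h i x - 1)\<^sup>2 \<partial>Q) \<le> s"
    and v: "(\<integral>x. (\<Sum>i\<in>I. h i x - 1)\<^sup>2 \<partial>Q) \<le> v"
    and T: "T \<in> borel_measurable (PiM I (\<lambda>_. Q))"
      "\<And>X. X \<in> space (PiM I (\<lambda>_. Q)) \<Longrightarrow> 0 \<le> T X \<and> T X \<le> 1"
      "\<And>X \<sigma>. X \<in> space (PiM I (\<lambda>_. Q)) \<Longrightarrow> \<sigma> permutes I \<Longrightarrow> T (X \<circ> \<sigma>) = T X"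
  shows "(\<integral>X. T X \<partial>PiM I (\<lambda>_. Q)) - sqrt (exp s * sqrt ((2 * s\<^sup>2 + v\<^sup>2) / (card I - 1)) + 2 * \<rho>)
      \<le> (\<integral>X. T X * (\<Prod>i\<in>I. h i (X i)) \<partial>PiM I (\<lambda>_. Q))"
proof -
  interpret Q: prob_space Q by (rule Q)
  interpret PP: product_prob_space "\<lambda>_. Q" I
    by (rule product_prob_spaceI) (rule Q)
  define R where "R = PiM I (\<lambda>_. Q)"
  interpret R: prob_space R
    unfolding R_def by (rule prob_space_PiM) (rule Q)
  define P where "P = {\<sigma>. \<sigma> permutes I}"
  define N :: real where "N = fact (card I)"
  have P: "finite P" "real (card P) = N"
    using finite_permutations[OF I(1)] card_permutations[OF refl I(1)] by (auto simp: P_def N_def)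
  have N: "N > 0" by (simp add: N_def)
  have in_I: "\<sigma> i \<in> I" if "\<sigma> \<in> P" "i \<in> I" for \<sigma> i
    using that by (simp add: P_def permutes_in_image)
  define H where "H \<sigma> X = (\<Prod>i\<in>I. h (\<sigma> i) (X i))" for \<sigma> X
  define G where "G i j = (\<integral>x. h i x * h j x \<partial>Q)" for i j
  define u where "u i x = h i x - 1" for i x
  define A where "A i j = (\<integral>x. u i x * u j x \<partial>Q)" for i j
  define c where "c i = (\<integral>x. h i x \<partial>Q)" for i
  have hh: "integrable Q (\<lambda>x. h i x * h j x)" if "i \<in> I" "j \<in> I" for i j
    using that by (intro integral_Cauchy_Schwarz h)
  have hi: "integrable Q (h i)" if "i \<in> I" for i
    using integral_Cauchy_Schwarz(1)[of "h i" Q "\<lambda>_. 1"] h that by simp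
  have um: "u i \<in> borel_measurable Q" if "i \<in> I" for i
    using h(1)[OF that] unfolding u_def by measurable
  have u2: "integrable Q (\<lambda>x. (u i x)\<^sup>2)" if "i \<in> I" for i
  proof -
    have "integrable Q (\<lambda>x. (h i x)\<^sup>2 - 2 * h i x + 1)"
      using h(3) hi that by auto
    then show ?thesis by (simp add: u_def power2_eq_square algebra_simps)
  qed
  have uu: "integrable Q (\<lambda>x. u i x * u j x)" if "i \<in> I" "j \<in> I" for i j
    using that by (intro integral_Cauchy_Schwarz um u2)
  have c01: "0 \<le> c i \<and> c i \<le> 1" if "i \<in> I" for i
    using h that by (auto simp: c_def)
  have G: "0 \<le> G i j \<and> G i j \<le> 1 + A i j" if "i \<in> I" "j \<in> I" for i j
  proof -
    have "G i j = (\<integral>x. u i x * u j x + h i x + h j x - 1 \<partial>Q)"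
      unfolding G_def u_def by (intro Bochner_Integration.integral_cong) (auto simp: algebra_simps)
    also have "\<dots> = A i j + c i + c j - 1"
      using uu[OF that] hi that by (simp add: A_def c_def Q.prob_space)
    finally have "G i j \<le> 1 + A i j" using c01[of i] c01[of j] that by linarith
    moreover have "0 \<le> G i j"
      using that h(2) by (auto simp: G_def)
    ultimately show ?thesis by simp
  qed
  have AV: "(\<Sum>i\<in>I. \<Sum>j\<in>I. A i j) = (\<integral>x. (\<Sum>i\<in>I. h i x - 1)\<^sup>2 \<partial>Q)"
  proof -
    have "(\<integral>x. (\<Sum>i\<in>I. h i x - 1)\<^sup>2 \<partial>Q) = (\<integral>x. (\<Sum>i\<in>I. \<Sum>j\<in>I. u i x * u j x) \<partial>Q)"
      by (simp add: power2_eq_square sum_product u_def)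
    also have "\<dots> = (\<Sum>i\<in>I. \<Sum>j\<in>I. A i j)"
      using uu by (simp add: A_def)
    finally show ?thesis ..
  qed
  have avg: "(\<Sum>\<sigma>\<in>P. \<Prod>i\<in>I. G i (\<sigma> i)) \<le> N * (1 + exp s * sqrt ((2 * s\<^sup>2 + v\<^sup>2) / (card I - 1)))"
    unfolding P_def N_def
  proof (rule permutation_product_average[OF I G])
    show "(A i j)\<^sup>2 \<le> A i i * A j j" if "i \<in> I" "j \<in> I" for i j
      using integral_Cauchy_Schwarz(2)[OF um um u2 u2] that by (simp add: A_def power2_eq_square)
    show "(\<Sum>i\<in>I. A i i) \<le> s" using s by (simp add: A_def u_def power2_eq_square)
    show "0 \<le> A i i" for i by (simp add: A_def)
    show "\<bar>\<Sum>i\<in>I. \<Sum>j\<in>I. A i j\<bar> \<le> v" using v unfolding AV by simp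
  qed
  have Hm: "H \<sigma> \<in> borel_measurable R" if "\<sigma> \<in> P" for \<sigma>
    unfolding H_def R_def
  proof (rule borel_measurable_prod)
    fix i assume "i \<in> I"
    then show "(\<lambda>X. h (\<sigma> i) (X i)) \<in> borel_measurable (PiM I (\<lambda>_. Q))"
      by (intro measurable_compose[OF _ h(1)[OF in_I[OF that \<open>i \<in> I\<close>]]] measurable_component_singleton)
  qed
  have H: "integrable R (H \<sigma>)" "(\<integral>X. H \<sigma> X \<partial>R) \<ge> 1 - \<rho>" if "\<sigma> \<in> P" for \<sigma>
  proof -
    have *: "integrable Q (h (\<sigma> i))" if "i \<in> I" for i
      using hi in_I[OF \<open>\<sigma> \<in> P\<close> that] by simp
    show "integrable R (H \<sigma>)"
      unfolding R_def H_def
      by (rule PP.product_integrable_prod[where f="\<lambda>i. h (\<sigma> i)", OF I(1) *])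
    have "(\<integral>X. H \<sigma> X \<partial>R) = (\<Prod>i\<in>I. c (\<sigma> i))"
      unfolding R_def H_def c_def
      by (rule PP.product_integral_prod[where f="\<lambda>i. h (\<sigma> i)", OF I(1) *])
    also have "\<dots> = (\<Prod>i\<in>I. c i)"
      using that by (intro prod.reindex_bij_betw permutes_imp_bij) (simp add: P_def)
    finally show "(\<integral>X. H \<sigma> X \<partial>R) \<ge> 1 - \<rho>"
      using one_minus_sum_le_prod[of I c, OF I(1) c01] \<rho> by (simp add: c_def)
  qed
  have HH: "integrable R (\<lambda>X. H \<sigma> X * H \<tau> X)"
      "(\<integral>X. H \<sigma> X * H \<tau> X \<partial>R) = (\<Prod>i\<in>I. G (\<sigma> i) (\<tau> i))" if "\<sigma> \<in> P" "\<tau> \<in> P" for \<sigma> \<tau>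
  proof -
    have eq: "H \<sigma> X * H \<tau> X = (\<Prod>i\<in>I. h (\<sigma> i) (X i) * h (\<tau> i) (X i))" for X
      by (simp add: H_def prod.distrib)
    have *: "integrable Q (\<lambda>x. h (\<sigma> i) x * h (\<tau> i) x)" if "i \<in> I" for i
      by (rule hh[OF in_I[OF \<open>\<sigma> \<in> P\<close> that] in_I[OF \<open>\<tau> \<in> P\<close> that]])
    show "integrable R (\<lambda>X. H \<sigma> X * H \<tau> X)"
      unfolding eq R_def
      by (rule PP.product_integrable_prod[where f="\<lambda>i x. h (\<sigma> i) x * h (\<tau> i) x", OF I(1) *])
    show "(\<integral>X. H \<sigma> X * H \<tau> X \<partial>R) = (\<Prod>i\<in>I. G (\<sigma> i) (\<tau> i))"
      unfolding eq R_def G_def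
      by (rule PP.product_integral_prod[where f="\<lambda>i x. h (\<sigma> i) x * h (\<tau> i) x", OF I(1) *])
  qed
  \<comment> \<open>The inner product of two permuted weights depends on the two permutations only through their
    quotient, so a double average is a single one.\<close>
  have sumHH: "(\<Sum>\<tau>\<in>P. \<integral>X. H \<sigma> X * H \<tau> X \<partial>R) = (\<Sum>\<tau>\<in>P. \<Prod>i\<in>I. G i (\<tau> i))" if "\<sigma> \<in> P" for \<sigma>
  proof -
    have \<sigma>: "\<sigma> permutes I" using that by (simp add: P_def)
    have "(\<Sum>\<tau>\<in>P. \<Prod>i\<in>I. G i (\<tau> i)) = (\<Sum>\<tau>\<in>P. \<Prod>i\<in>I. G i ((\<tau> \<circ> inv \<sigma>) i))"
      unfolding P_def by (rule sum_permutations_compose_right) (rule permutes_inv[OF \<sigma>])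
    also have "\<dots> = (\<Sum>\<tau>\<in>P. \<Prod>i\<in>I. G (\<sigma> i) (\<tau> i))"
    proof (rule sum.cong)
      fix \<tau>
      have "(\<Prod>i\<in>I. G i ((\<tau> \<circ> inv \<sigma>) i)) = (\<Prod>i\<in>I. G (\<sigma> i) ((\<tau> \<circ> inv \<sigma>) (\<sigma> i)))"
        by (rule prod.reindex_bij_betw[symmetric]) (rule permutes_imp_bij[OF \<sigma>])
      then show "(\<Prod>i\<in>I. G i ((\<tau> \<circ> inv \<sigma>) i)) = (\<Prod>i\<in>I. G (\<sigma> i) (\<tau> i))"
        by (simp add: permutes_inverses[OF \<sigma>])
    qed simp
    also have "\<dots> = (\<Sum>\<tau>\<in>P. \<integral>X. H \<sigma> X * H \<tau> X \<partial>R)"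
      using HH(2)[OF that] by simp
    finally show ?thesis ..
  qed
  define L where "L X = (\<Sum>\<sigma>\<in>P. H \<sigma> X) / N" for X
  have Lm: "L \<in> borel_measurable R"
    unfolding L_def using Hm by (intro borel_measurable_divide borel_measurable_sum) auto
  have L: "integrable R L" "(\<integral>X. L X \<partial>R) \<ge> 1 - \<rho>"
  proof -
    show "integrable R L" unfolding L_def using H(1) by auto
    have "N * (1 - \<rho>) = (\<Sum>\<sigma>\<in>P. 1 - \<rho>)" by (simp add: P(2))
    also have "\<dots> \<le> (\<Sum>\<sigma>\<in>P. \<integral>X. H \<sigma> X \<partial>R)" by (intro sum_mono H)
    also have "\<dots> = N * (\<integral>X. L X \<partial>R)" unfolding L_def using H(1) N by simp
    finally show "(\<integral>X. L X \<partial>R) \<ge> 1 - \<rho>" using N by simp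
  qed
  have L2eq: "(L X)\<^sup>2 = (\<Sum>\<sigma>\<in>P. \<Sum>\<tau>\<in>P. H \<sigma> X * H \<tau> X) / N\<^sup>2" for X
    by (simp add: L_def power_divide power2_eq_square sum_product)
  have L2: "integrable R (\<lambda>X. (L X)\<^sup>2)"
      "(\<integral>X. (L X)\<^sup>2 \<partial>R) \<le> 1 + exp s * sqrt ((2 * s\<^sup>2 + v\<^sup>2) / (card I - 1))"
  proof -
    show "integrable R (\<lambda>X. (L X)\<^sup>2)" unfolding L2eq using HH(1) by auto
    have "(\<integral>X. (L X)\<^sup>2 \<partial>R) = (\<Sum>\<sigma>\<in>P. \<Sum>\<tau>\<in>P. \<integral>X. H \<sigma> X * H \<tau> X \<partial>R) / N\<^sup>2"
      unfolding L2eq using HH(1) by simp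
    also have "\<dots> = (\<Sum>\<tau>\<in>P. \<Prod>i\<in>I. G i (\<tau> i)) / N"
      using sumHH P(2) N by (simp add: power2_eq_square)
    also have "\<dots> \<le> 1 + exp s * sqrt ((2 * s\<^sup>2 + v\<^sup>2) / (card I - 1))"
      using avg N by (simp add: divide_le_eq mult.commute)
    finally show "(\<integral>X. (L X)\<^sup>2 \<partial>R) \<le> 1 + exp s * sqrt ((2 * s\<^sup>2 + v\<^sup>2) / (card I - 1))" .
  qed
  define D where "D = exp s * sqrt ((2 * s\<^sup>2 + v\<^sup>2) / (card I - 1)) + 2 * \<rho>"
  have L1: "integrable R (\<lambda>X. (L X - 1)\<^sup>2)" "(\<integral>X. (L X - 1)\<^sup>2 \<partial>R) \<le> D"
  proof -
    have eq: "(L X - 1)\<^sup>2 = (L X)\<^sup>2 - 2 * L X + 1" for X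
      by (simp add: power2_eq_square algebra_simps)
    show "integrable R (\<lambda>X. (L X - 1)\<^sup>2)"
      unfolding eq using L L2 by auto
    have "(\<integral>X. (L X - 1)\<^sup>2 \<partial>R) = (\<integral>X. (L X)\<^sup>2 \<partial>R) - 2 * (\<integral>X. L X \<partial>R) + 1"
      unfolding eq using L L2 by (simp add: R.prob_space)
    then show "(\<integral>X. (L X - 1)\<^sup>2 \<partial>R) \<le> D" using L L2 by (simp add: D_def)
  qed
  have Tm: "T \<in> borel_measurable R" using T by (simp add: R_def)
  have bT: "integrable R (\<lambda>X. (T X)\<^sup>2)" "(\<integral>X. (T X)\<^sup>2 \<partial>R) \<le> 1" "integrable R T"
  proof -
    have b: "AE X in R. norm ((T X)\<^sup>2) \<le> 1"
      using T(2) by (auto simp: R_def power_le_one_iff intro!: AE_I2)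
    show i: "integrable R (\<lambda>X. (T X)\<^sup>2)"
      using Tm b by (intro R.integrable_const_bound[where B=1]) auto
    show "integrable R T"
      using Tm T(2) by (intro R.integrable_const_bound[where B=1]) (auto simp: R_def intro!: AE_I2)
    have "(\<integral>X. (T X)\<^sup>2 \<partial>R) \<le> (\<integral>X. 1 \<partial>R)"
      using i b by (intro integral_mono_AE) auto
    then show "(\<integral>X. (T X)\<^sup>2 \<partial>R) \<le> 1" by (simp add: R.prob_space)
  qed
  \<comment> \<open>The i.i.d. law and \<open>T\<close> are both invariant, so permuting the weight does not change the integral.\<close>
  have TH: "integrable R (\<lambda>X. T X * H \<sigma> X)" "(\<integral>X. T X * H \<sigma> X \<partial>R) = (\<integral>X. T X * H id X \<partial>R)"
    if "\<sigma> \<in> P" for \<sigma>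
  proof -
    have \<sigma>: "\<sigma> permutes I" using that by (simp add: P_def)
    show "integrable R (\<lambda>X. T X * H \<sigma> X)"
      using HH(1)[OF that that] bT(1) by (intro integral_Cauchy_Schwarz Tm Hm that) (auto simp: power2_eq_square)
    have id: "id \<in> P" by (simp add: P_def permutes_id)
    have "(\<integral>X. T X * H id X \<partial>R) = (\<integral>X. T X * H id X \<partial>distr R R (\<lambda>X. X \<circ> inv \<sigma>))"
      unfolding R_def by (subst distr_PiM_permutes[OF I(1) Q permutes_inv[OF \<sigma>]]) simp
    also have "\<dots> = (\<integral>X. T (X \<circ> inv \<sigma>) * H id (X \<circ> inv \<sigma>) \<partial>R)"
      using Tm Hm[OF id] measurable_comp_permutes[OF permutes_inv[OF \<sigma>], of Q]
      by (intro integral_distr borel_measurable_times) (auto simp: R_def)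
    also have "\<dots> = (\<integral>X. T X * H \<sigma> X \<partial>R)"
    proof (intro Bochner_Integration.integral_cong refl arg_cong2[where f="(*)"])
      fix X assume "X \<in> space R"
      then show "T (X \<circ> inv \<sigma>) = T X"
        using T(3) permutes_inv[OF \<sigma>] by (simp add: R_def)
      have "H id (X \<circ> inv \<sigma>) = (\<Prod>i\<in>I. h (\<sigma> i) ((X \<circ> inv \<sigma>) (\<sigma> i)))"
        unfolding H_def id_apply
        by (rule prod.reindex_bij_betw[symmetric]) (rule permutes_imp_bij[OF \<sigma>])
      then show "H id (X \<circ> inv \<sigma>) = H \<sigma> X"
        by (simp add: H_def permutes_inverses[OF \<sigma>])
    qed
    finally show "(\<integral>X. T X * H \<sigma> X \<partial>R) = (\<integral>X. T X * H id X \<partial>R)" ..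
  qed
  have TL: "integrable R (\<lambda>X. T X * L X)" "(\<integral>X. T X * L X \<partial>R) = (\<integral>X. T X * H id X \<partial>R)"
  proof -
    have eq: "T X * L X = (\<Sum>\<sigma>\<in>P. T X * H \<sigma> X) / N" for X
      by (simp add: L_def sum_distrib_left)
    show "integrable R (\<lambda>X. T X * L X)" unfolding eq using TH(1) by auto
    show "(\<integral>X. T X * L X \<partial>R) = (\<integral>X. T X * H id X \<partial>R)"
      unfolding eq using TH P(2) N by simp
  qed
  have "(\<integral>X. T X * (L X - 1) \<partial>R)\<^sup>2 \<le> (\<integral>X. (T X)\<^sup>2 \<partial>R) * (\<integral>X. (L X - 1)\<^sup>2 \<partial>R)"
    using Tm Lm bT L1 by (intro integral_Cauchy_Schwarz) auto
  also have "\<dots> \<le> 1 * D"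
    using bT L1 by (intro mult_mono) auto
  finally have "\<bar>\<integral>X. T X * (L X - 1) \<partial>R\<bar> \<le> sqrt D"
    using real_le_rsqrt by fastforce
  moreover have "(\<integral>X. T X * (L X - 1) \<partial>R) = (\<integral>X. T X * H id X \<partial>R) - (\<integral>X. T X \<partial>R)"
    using TL bT by (simp add: right_diff_distrib)
  ultimately show ?thesis
    by (simp add: D_def R_def H_def)
qed

section \<open>Truncated likelihood ratios\<close>

text \<open>
  Likelihood ratios of an exponential family need not be square integrable, because \<open>2 \<eta> - \<theta>\<close> can leave
  the natural parameter space. Cutting the ratio to 0 where its logarithm is large cures this, and the
  tail bound below shows that the lost mass is of second order.
\<close>

definition truncated_exp :: "real \<Rightarrow> real \<Rightarrow> real" where
  "truncated_exp B y = (if \<bar>y\<bar> \<le> B then exp y else 0)"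

lemma truncated_exp_measurable [measurable]: "truncated_exp B \<in> borel_measurable borel"
  unfolding truncated_exp_def by measurable

lemma truncated_exp_bounds: "0 \<le> truncated_exp B y" "truncated_exp B y \<le> exp y" "truncated_exp B y \<le> exp B"
  by (auto simp: truncated_exp_def)

lemma abs_exp_minus_one_le:
  fixes y :: real
  assumes "\<bar>y\<bar> \<le> B"
  shows "\<bar>exp y - 1\<bar> \<le> \<bar>y\<bar> * exp B"
proof (cases "y \<ge> 0")
  case True
  then show ?thesis using exp_le_one_plus_abs[of y B] assms by simp
next
  case False
  then have "exp y \<le> 1" by simp
  then have "\<bar>exp y - 1\<bar> \<le> \<bar>y\<bar> * 1"
    using False exp_ge_add_one_self[of y] by linarith
  also have "\<dots> \<le> \<bar>y\<bar> * exp B" using assms by (intro mult_left_mono) auto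
  finally show ?thesis .
qed

lemma truncated_exp_minus_one:
  assumes "B \<ge> 1"
  shows "(truncated_exp B y - 1)\<^sup>2 \<le> exp (2 * B) * y\<^sup>2"
proof -
  have "\<bar>truncated_exp B y - 1\<bar> \<le> \<bar>y\<bar> * exp B"
  proof (cases "\<bar>y\<bar> \<le> B")
    case False
    then have "1 * 1 \<le> \<bar>y\<bar> * exp B" using assms by (intro mult_mono) auto
    then show ?thesis using False by (simp add: truncated_exp_def)
  qed (simp add: truncated_exp_def abs_exp_minus_one_le)
  then have "\<bar>truncated_exp B y - 1\<bar>\<^sup>2 \<le> (\<bar>y\<bar> * exp B)\<^sup>2"
    by (intro power_mono) auto
  then show ?thesis by (simp add: power_mult_distrib exp_double mult.commute[of "y\<^sup>2"])
qed

lemma truncated_exp_taylor: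
  assumes "B \<ge> 1"
  shows "\<bar>truncated_exp B y - 1 - y\<bar> \<le> 2 * exp B * y\<^sup>2"
proof (cases "\<bar>y\<bar> \<le> B")
  case True
  have "(1 - y) * exp y \<le> exp (- y) * exp y"
    using exp_ge_add_one_self[of "- y"] by (intro mult_right_mono) auto
  then have "exp y - 1 - y \<le> y * (exp y - 1)" by (simp add: algebra_simps flip: exp_add)
  also have "\<dots> \<le> \<bar>y\<bar> * (\<bar>y\<bar> * exp B)"
  proof -
    have "y * (exp y - 1) \<le> \<bar>y\<bar> * \<bar>exp y - 1\<bar>" by (simp flip: abs_mult)
    also have "\<dots> \<le> \<bar>y\<bar> * (\<bar>y\<bar> * exp B)" by (intro mult_left_mono abs_exp_minus_one_le True) auto
    finally show ?thesis .
  qed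
  also have "\<dots> = exp B * y\<^sup>2" by (simp add: power2_eq_square flip: abs_mult)
  also have "\<dots> \<le> 2 * exp B * y\<^sup>2" by simp
  finally have "\<bar>exp y - 1 - y\<bar> \<le> 2 * exp B * y\<^sup>2"
    using exp_ge_add_one_self[of y] by linarith
  then show ?thesis using True by (simp add: truncated_exp_def)
next
  case False
  have y: "1 \<le> \<bar>y\<bar>" using False assms by simp
  then have "\<bar>y\<bar> * 1 \<le> \<bar>y\<bar> * \<bar>y\<bar>" by (intro mult_left_mono) auto
  then have "\<bar>y\<bar> \<le> y\<^sup>2" by (simp add: power2_eq_square flip: abs_mult)
  then have "\<bar>truncated_exp B y - 1 - y\<bar> \<le> 2 * y\<^sup>2"
    using y False unfolding truncated_exp_def by simp
  also have "\<dots> \<le> exp B * (2 * y\<^sup>2)"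
    using mult_right_mono[of 1 "exp B" "2 * y\<^sup>2"] assms by simp
  finally show ?thesis by simp
qed

lemma truncated_exp_tail:
  assumes "B \<ge> 1"
  shows "exp y - truncated_exp B y \<le> exp y * y\<^sup>2 / B\<^sup>2"
proof (cases "\<bar>y\<bar> \<le> B")
  case False
  then have "B\<^sup>2 \<le> \<bar>y\<bar>\<^sup>2" using assms by (intro power_mono) auto
  then have "exp y * B\<^sup>2 \<le> exp y * y\<^sup>2" by simp
  then show ?thesis using False assms by (simp add: truncated_exp_def field_simps)
qed (simp add: truncated_exp_def)

text \<open>
  Here \<open>g\<close> bounds the moments, \<open>\<tau>\<close> bounds the squared distance of the parameters from their mean, and
  \<open>B\<close> is the truncation level. The last summand under the root is twice the truncated mass; it is
  independent of \<open>n\<close> and made small by the choice of \<open>B\<close>, after which the first summand tends to 0 with \<open>n\<close>.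
\<close>

definition test_error :: "real \<Rightarrow> real \<Rightarrow> real \<Rightarrow> nat \<Rightarrow> real" where
  "test_error g \<tau> B n =
    sqrt (exp (exp (2 * B) * g * \<tau>)
            * sqrt ((2 * (exp (2 * B) * g * \<tau>)\<^sup>2 + (exp (2 * B) * \<tau>\<^sup>2 * (18 * g\<^sup>2 + 8 * g))\<^sup>2) / (n - 1))
          + 2 * (g * \<tau> / B\<^sup>2))"

text \<open>
  The weights are the truncated ratios \<open>h i = truncated_exp B (l i)\<close>. Each \<open>h i - 1\<close> equals \<open>l i\<close> up to a
  remainder of order \<open>(l i)\<^sup>2\<close>, and so has squared norm of order \<open>(t i)\<^sup>2\<close>. The sum of the \<open>h i - 1\<close> needs
  more care, since the sum of the \<open>t i\<close> may grow like the square root of \<open>card I\<close>. This is where \<open>l_const\<close> enters: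
  the linear terms add up to a constant, hence to the sum of their means, and \<open>1 + O((t i)\<^sup>2)\<close>
  as the mean of \<open>h i\<close> forces each mean to be of order \<open>(t i)\<^sup>2\<close>. So both bounds are uniform in \<open>card I\<close>.
\<close>

lemma product_likelihood_test_lower_bound:
  fixes l :: "'i \<Rightarrow> 'a \<Rightarrow> real" and W :: "'a \<Rightarrow> real" and T :: "('i \<Rightarrow> 'a) \<Rightarrow> real"
  assumes Q: "prob_space Q" and I: "finite I" "card I \<ge> 2"
    and lm: "\<And>i. i \<in> I \<Longrightarrow> l i \<in> borel_measurable Q"
    and P: "\<And>i. i \<in> I \<Longrightarrow> prob_space (density Q (\<lambda>x. ennreal (exp (l i x))))"
    and l_const: "\<And>x. (\<Sum>i\<in>I. l i x) = \<kappa>"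
    and l_le: "\<And>i x. i \<in> I \<Longrightarrow> \<bar>l i x\<bar> \<le> t i * W x" and \<tau>: "(\<Sum>i\<in>I. (t i)\<^sup>2) \<le> \<tau>"
    and Wm: "W \<in> borel_measurable Q"
    and W4: "integrable Q (\<lambda>x. (W x) ^ 4)" "(\<integral>x. (W x) ^ 4 \<partial>Q) \<le> g"
    and W2: "integrable Q (\<lambda>x. (W x)\<^sup>2)" "(\<integral>x. (W x)\<^sup>2 \<partial>Q) \<le> g"
    and W2P: "\<And>i. i \<in> I \<Longrightarrow> (\<integral>\<^sup>+x. ennreal ((W x)\<^sup>2) \<partial>density Q (\<lambda>x. ennreal (exp (l i x)))) \<le> ennreal g"
    and B: "B \<ge> 1"
    and T: "T \<in> borel_measurable (PiM I (\<lambda>_. Q))"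
      "\<And>X. X \<in> space (PiM I (\<lambda>_. Q)) \<Longrightarrow> 0 \<le> T X \<and> T X \<le> 1"
      "\<And>X \<sigma>. X \<in> space (PiM I (\<lambda>_. Q)) \<Longrightarrow> \<sigma> permutes I \<Longrightarrow> T (X \<circ> \<sigma>) = T X"
  shows "(\<integral>X. T X \<partial>PiM I (\<lambda>_. Q))
        - test_error g \<tau> B (card I)
      \<le> (\<integral>X. T X \<partial>PiM I (\<lambda>i. density Q (\<lambda>x. ennreal (exp (l i x)))))"
proof -
  interpret Q: prob_space Q by (rule Q)
  define R where "R = PiM I (\<lambda>_. Q)"
  interpret R: prob_space R
    unfolding R_def by (rule prob_space_PiM) (rule Q)
  interpret PP: product_prob_space "\<lambda>_. Q" I
    by (rule product_prob_spaceI) (rule Q)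
  define h where "h i x = truncated_exp B (l i x)" for i x
  have g: "0 \<le> g" using W2(2) by (rule order_trans[rotated]) simp
  have em: "(\<lambda>x. exp (l i x)) \<in> borel_measurable Q" if "i \<in> I" for i
    using lm[OF that] by measurable
  have hm: "h i \<in> borel_measurable Q" if "i \<in> I" for i
    unfolding h_def using lm[OF that] by measurable
  have e: "integrable Q (\<lambda>x. exp (l i x))" "(\<integral>x. exp (l i x) \<partial>Q) = 1" if "i \<in> I" for i
  proof -
    have "(\<integral>\<^sup>+x. ennreal (exp (l i x)) \<partial>Q) = 1"
      using prob_space.emeasure_space_1[OF P[OF that]] em[OF that]
      by (simp add: emeasure_density cong: nn_integral_cong)
    then have "has_bochner_integral Q (\<lambda>x. exp (l i x)) 1"
      using em[OF that] by (intro has_bochner_integral_nn_integral) auto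
    then show "integrable Q (\<lambda>x. exp (l i x))" "(\<integral>x. exp (l i x) \<partial>Q) = 1"
      by (auto simp: has_bochner_integral_iff)
  qed
  have l2_le: "(l i x)\<^sup>2 \<le> (t i)\<^sup>2 * (W x)\<^sup>2" if "i \<in> I" for i x
    using power_mono[OF l_le[OF that, of x], of 2] by (simp add: power_mult_distrib)
  have l2: "integrable Q (\<lambda>x. (l i x)\<^sup>2)" "(\<integral>x. (l i x)\<^sup>2 \<partial>Q) \<le> (t i)\<^sup>2 * g" if "i \<in> I" for i
  proof -
    show i: "integrable Q (\<lambda>x. (l i x)\<^sup>2)"
      by (rule Bochner_Integration.integrable_bound[of Q "\<lambda>x. (t i)\<^sup>2 * (W x)\<^sup>2"])
        (use W2(1) lm[OF that] l2_le[OF that] in auto)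
    have "(\<integral>x. (l i x)\<^sup>2 \<partial>Q) \<le> (\<integral>x. (t i)\<^sup>2 * (W x)\<^sup>2 \<partial>Q)"
      using W2(1) l2_le[OF that] by (intro integral_mono i) auto
    also have "\<dots> \<le> (t i)\<^sup>2 * g" using W2(2) by (simp add: mult_left_mono)
    finally show "(\<integral>x. (l i x)\<^sup>2 \<partial>Q) \<le> (t i)\<^sup>2 * g" .
  qed
  have li: "integrable Q (l i)" if "i \<in> I" for i
    using integral_Cauchy_Schwarz(1)[of "l i" Q "\<lambda>_. 1"] lm l2(1) that by simp
  have el2: "integrable Q (\<lambda>x. exp (l i x) * (l i x)\<^sup>2)" "(\<integral>x. exp (l i x) * (l i x)\<^sup>2 \<partial>Q) \<le> (t i)\<^sup>2 * g"
    if "i \<in> I" for i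
  proof -
    have "(\<integral>\<^sup>+x. ennreal (exp (l i x) * (l i x)\<^sup>2) \<partial>Q)
        \<le> (\<integral>\<^sup>+x. ennreal ((t i)\<^sup>2) * (ennreal (exp (l i x)) * ennreal ((W x)\<^sup>2)) \<partial>Q)"
    proof (rule nn_integral_mono)
      fix x
      have "exp (l i x) * (l i x)\<^sup>2 \<le> (t i)\<^sup>2 * (exp (l i x) * (W x)\<^sup>2)"
        using mult_left_mono[OF l2_le[OF that, of x], of "exp (l i x)"] by (simp add: mult_ac)
      then show "ennreal (exp (l i x) * (l i x)\<^sup>2) \<le> ennreal ((t i)\<^sup>2) * (ennreal (exp (l i x)) * ennreal ((W x)\<^sup>2))"
        by (simp add: ennreal_leI flip: ennreal_mult)
    qed
    also have "\<dots> = ennreal ((t i)\<^sup>2) * (\<integral>\<^sup>+x. ennreal (exp (l i x)) * ennreal ((W x)\<^sup>2) \<partial>Q)"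
      using em[OF that] Wm by (intro nn_integral_cmult) auto
    also have "(\<integral>\<^sup>+x. ennreal (exp (l i x)) * ennreal ((W x)\<^sup>2) \<partial>Q) \<le> ennreal g"
      using W2P[OF that] em[OF that] Wm by (simp add: nn_integral_density)
    finally have *: "(\<integral>\<^sup>+x. ennreal (exp (l i x) * (l i x)\<^sup>2) \<partial>Q) \<le> ennreal ((t i)\<^sup>2 * g)"
      by (simp add: ennreal_mult g mult_left_mono)
    show i: "integrable Q (\<lambda>x. exp (l i x) * (l i x)\<^sup>2)"
      using lm[OF that] em[OF that] le_less_trans[OF *] by (intro integrableI_nonneg) auto
    show "(\<integral>x. exp (l i x) * (l i x)\<^sup>2 \<partial>Q) \<le> (t i)\<^sup>2 * g"
      using * g by (subst (asm) nn_integral_eq_integral[OF i]) auto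
  qed
  have hB: "0 \<le> h i x" "h i x \<le> exp (l i x)" "h i x \<le> exp B" for i x
    unfolding h_def by (rule truncated_exp_bounds)+
  have hi: "integrable Q (h i)" if "i \<in> I" for i
    using hm[OF that] hB by (intro Q.integrable_const_bound[where B="exp B"]) auto
  have h2: "integrable Q (\<lambda>x. (h i x)\<^sup>2)" if "i \<in> I" for i
    using hm[OF that] hB
    by (intro Q.integrable_const_bound[where B="(exp B)\<^sup>2"]) (auto intro!: power_mono AE_I2)
  have h_le: "(\<integral>x. h i x \<partial>Q) \<le> 1" if "i \<in> I" for i
    using integral_mono[OF hi[OF that] e(1)[OF that] hB(2)] e(2)[OF that] by simp
  \<comment> \<open>The missing mass is a tail probability under the law with density \<open>exp (l i x)\<close>; Chebyshev.\<close>
  have tail: "1 - (\<integral>x. h i x \<partial>Q) \<le> (t i)\<^sup>2 * (g / B\<^sup>2)" if "i \<in> I" for i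
  proof -
    have d: "integrable Q (\<lambda>x. exp (l i x) - h i x)"
      using e(1)[OF that] hi[OF that] by simp
    have "1 - (\<integral>x. h i x \<partial>Q) = (\<integral>x. exp (l i x) - h i x \<partial>Q)"
      using e[OF that] hi[OF that] by simp
    also have "\<dots> \<le> (\<integral>x. exp (l i x) * (l i x)\<^sup>2 / B\<^sup>2 \<partial>Q)"
      using el2(1)[OF that] by (intro integral_mono d) (simp_all add: h_def truncated_exp_tail[OF B])
    also have "\<dots> \<le> (t i)\<^sup>2 * g / B\<^sup>2"
      using el2[OF that] by (simp add: divide_right_mono)
    finally show ?thesis by simp
  qed
  define r where "r i x = h i x - 1 - l i x" for i x
  have r: "\<bar>r i x\<bar> \<le> 2 * exp B * (l i x)\<^sup>2" for i x
    unfolding r_def h_def by (rule truncated_exp_taylor[OF B])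
  have ri: "integrable Q (r i)" if "i \<in> I" for i
    unfolding r_def using hi li that by auto
  have mean_l: "\<bar>\<integral>x. l i x \<partial>Q\<bar> \<le> 3 * exp B * g * (t i)\<^sup>2" if "i \<in> I" for i
  proof -
    have "(\<integral>x. r i x \<partial>Q) = (\<integral>x. h i x \<partial>Q) - 1 - (\<integral>x. l i x \<partial>Q)"
      unfolding r_def using hi[OF that] li[OF that] by (simp add: Q.prob_space)
    moreover have "\<bar>\<integral>x. r i x \<partial>Q\<bar> \<le> 2 * exp B * ((t i)\<^sup>2 * g)"
    proof -
      have "\<bar>\<integral>x. r i x \<partial>Q\<bar> \<le> (\<integral>x. \<bar>r i x\<bar> \<partial>Q)" by (rule integral_abs_bound)
      also have "\<dots> \<le> (\<integral>x. 2 * exp B * (l i x)\<^sup>2 \<partial>Q)"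
        using ri[OF that] l2(1)[OF that] r by (intro integral_mono) auto
      also have "\<dots> \<le> 2 * exp B * ((t i)\<^sup>2 * g)" using l2[OF that] by simp
      finally show ?thesis .
    qed
    moreover have "(t i)\<^sup>2 * (g / B\<^sup>2) \<le> exp B * ((t i)\<^sup>2 * g)"
    proof -
      have "1 \<le> B\<^sup>2" "1 \<le> exp B" using B by auto
      then have "(t i)\<^sup>2 * (g / B\<^sup>2) \<le> (t i)\<^sup>2 * g" "(t i)\<^sup>2 * g \<le> exp B * ((t i)\<^sup>2 * g)"
        using g mult_right_mono[of 1 "exp B" "(t i)\<^sup>2 * g"] mult_left_mono[of 1 "B\<^sup>2" "(t i)\<^sup>2 * g"] B
        by (auto simp: divide_le_eq)
      then show ?thesis by simp
    qed
    ultimately have "\<bar>\<integral>x. l i x \<partial>Q\<bar> \<le> 3 * (exp B * ((t i)\<^sup>2 * g))"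
      using tail[OF that] h_le[OF that] by linarith
    then show ?thesis by (simp add: mult_ac)
  qed
  have \<tau>0: "0 \<le> \<tau>" using \<tau> by (rule order_trans[rotated]) (simp add: sum_nonneg)
  have sum_bound: "\<bar>\<Sum>i\<in>I. h i x - 1\<bar> \<le> exp B * \<tau> * (3 * g + 2 * (W x)\<^sup>2)" for x
  proof -
    have "\<kappa> = (\<integral>x. (\<Sum>i\<in>I. l i x) \<partial>Q)" by (simp add: l_const Q.prob_space)
    also have "\<dots> = (\<Sum>i\<in>I. \<integral>x. l i x \<partial>Q)" using li by simp
    finally have \<kappa>: "\<kappa> = (\<Sum>i\<in>I. \<integral>x. l i x \<partial>Q)" .
    have "(\<Sum>i\<in>I. h i x - 1) = (\<Sum>i\<in>I. l i x) + (\<Sum>i\<in>I. r i x)"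
      by (simp add: r_def flip: sum.distrib)
    also have "\<dots> = (\<Sum>i\<in>I. (\<integral>x. l i x \<partial>Q) + r i x)"
      by (simp add: l_const \<kappa> sum.distrib)
    finally have "\<bar>\<Sum>i\<in>I. h i x - 1\<bar> \<le> (\<Sum>i\<in>I. \<bar>(\<integral>x. l i x \<partial>Q) + r i x\<bar>)"
      by (simp add: sum_abs)
    also have "\<dots> \<le> (\<Sum>i\<in>I. (t i)\<^sup>2 * (exp B * (3 * g + 2 * (W x)\<^sup>2)))"
    proof (rule sum_mono)
      fix i assume i: "i \<in> I"
      have "\<bar>r i x\<bar> \<le> 2 * exp B * ((t i)\<^sup>2 * (W x)\<^sup>2)"
        using r[of i x] mult_left_mono[OF l2_le[OF i, of x], of "2 * exp B"]
        by (meson exp_ge_zero mult_nonneg_nonneg order_trans zero_le_numeral)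
      then have "\<bar>(\<integral>x. l i x \<partial>Q) + r i x\<bar> \<le> 3 * exp B * g * (t i)\<^sup>2 + 2 * exp B * ((t i)\<^sup>2 * (W x)\<^sup>2)"
        using mean_l[OF i] by linarith
      also have "\<dots> = (t i)\<^sup>2 * (exp B * (3 * g + 2 * (W x)\<^sup>2))" by (simp add: algebra_simps)
      finally show "\<bar>(\<integral>x. l i x \<partial>Q) + r i x\<bar> \<le> (t i)\<^sup>2 * (exp B * (3 * g + 2 * (W x)\<^sup>2))" .
    qed
    also have "\<dots> = (\<Sum>i\<in>I. (t i)\<^sup>2) * (exp B * (3 * g + 2 * (W x)\<^sup>2))"
      by (simp add: sum_distrib_right)
    also have "\<dots> \<le> \<tau> * (exp B * (3 * g + 2 * (W x)\<^sup>2))"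
      using \<tau> g by (intro mult_right_mono) auto
    finally show ?thesis by (simp add: mult_ac)
  qed
  have v: "(\<integral>x. (\<Sum>i\<in>I. h i x - 1)\<^sup>2 \<partial>Q) \<le> exp (2 * B) * \<tau>\<^sup>2 * (18 * g\<^sup>2 + 8 * g)"
  proof -
    have le: "(\<Sum>i\<in>I. h i x - 1)\<^sup>2 \<le> exp (2 * B) * \<tau>\<^sup>2 * (18 * g\<^sup>2 + 8 * (W x) ^ 4)" for x
    proof -
      have "(\<Sum>i\<in>I. h i x - 1)\<^sup>2 \<le> (exp B * \<tau> * (3 * g + 2 * (W x)\<^sup>2))\<^sup>2"
        using power_mono[OF sum_bound[of x], of 2] by simp
      also have "\<dots> = exp (2 * B) * \<tau>\<^sup>2 * (3 * g + 2 * (W x)\<^sup>2)\<^sup>2"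
        by (simp add: power_mult_distrib exp_double)
      also have "(3 * g + 2 * (W x)\<^sup>2)\<^sup>2 \<le> 18 * g\<^sup>2 + 8 * (W x) ^ 4"
        using sum_squares_bound[of "3 * g" "2 * (W x)\<^sup>2"] by (simp add: power2_sum power_mult_distrib)
      finally show ?thesis by (simp add: mult_left_mono)
    qed
    have "(\<integral>x. (\<Sum>i\<in>I. h i x - 1)\<^sup>2 \<partial>Q) \<le> (\<integral>x. exp (2 * B) * \<tau>\<^sup>2 * (18 * g\<^sup>2 + 8 * (W x) ^ 4) \<partial>Q)"
      using le W4(1) by (intro integral_mono') auto
    also have "\<dots> = exp (2 * B) * \<tau>\<^sup>2 * (18 * g\<^sup>2 + 8 * (\<integral>x. (W x) ^ 4 \<partial>Q))"
      using W4(1) by (simp add: Q.prob_space)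
    also have "\<dots> \<le> exp (2 * B) * \<tau>\<^sup>2 * (18 * g\<^sup>2 + 8 * g)"
      using W4(2) by (intro mult_left_mono) auto
    finally show ?thesis .
  qed
  have s: "(\<Sum>i\<in>I. \<integral>x. (h i x - 1)\<^sup>2 \<partial>Q) \<le> exp (2 * B) * g * \<tau>"
  proof -
    have "(\<Sum>i\<in>I. \<integral>x. (h i x - 1)\<^sup>2 \<partial>Q) \<le> (\<Sum>i\<in>I. exp (2 * B) * g * (t i)\<^sup>2)"
    proof (rule sum_mono)
      fix i assume i: "i \<in> I"
      have "(\<integral>x. (h i x - 1)\<^sup>2 \<partial>Q) \<le> (\<integral>x. exp (2 * B) * (l i x)\<^sup>2 \<partial>Q)"
        using truncated_exp_minus_one[OF B] l2(1)[OF i] by (intro integral_mono') (auto simp: h_def)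
      also have "\<dots> \<le> exp (2 * B) * ((t i)\<^sup>2 * g)" using l2[OF i] by simp
      finally show "(\<integral>x. (h i x - 1)\<^sup>2 \<partial>Q) \<le> exp (2 * B) * g * (t i)\<^sup>2" by (simp add: mult_ac)
    qed
    also have "\<dots> = exp (2 * B) * g * (\<Sum>i\<in>I. (t i)\<^sup>2)" by (simp add: sum_distrib_left)
    also have "\<dots> \<le> exp (2 * B) * g * \<tau>" using \<tau> g by (intro mult_left_mono) auto
    finally show ?thesis .
  qed
  have \<rho>: "(\<Sum>i\<in>I. 1 - (\<integral>x. h i x \<partial>Q)) \<le> g * \<tau> / B\<^sup>2"
  proof -
    have "(\<Sum>i\<in>I. 1 - (\<integral>x. h i x \<partial>Q)) \<le> (\<Sum>i\<in>I. (t i)\<^sup>2 * (g / B\<^sup>2))"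
      by (intro sum_mono tail)
    also have "\<dots> = (\<Sum>i\<in>I. (t i)\<^sup>2) * (g / B\<^sup>2)" by (simp only: sum_distrib_right)
    also have "\<dots> \<le> \<tau> * (g / B\<^sup>2)" using \<tau> g by (intro mult_right_mono) auto
    finally show ?thesis by (simp add: mult.commute)
  qed
  have Tm: "T \<in> borel_measurable R" using T(1) by (simp add: R_def)
  have TP: "integrable R (\<lambda>X. T X * (\<Prod>i\<in>I. f i (X i)))"
    if f: "\<And>i. i \<in> I \<Longrightarrow> integrable Q (f i)" for f
  proof (rule Bochner_Integration.integrable_bound)
    show F: "integrable R (\<lambda>X. \<Prod>i\<in>I. f i (X i))"
      unfolding R_def by (rule PP.product_integrable_prod[OF I(1) f])
    show "(\<lambda>X. T X * (\<Prod>i\<in>I. f i (X i))) \<in> borel_measurable R"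
      using Tm borel_measurable_integrable[OF F] by measurable
    show "AE X in R. norm (T X * (\<Prod>i\<in>I. f i (X i))) \<le> norm (\<Prod>i\<in>I. f i (X i))"
      using T(2) by (intro AE_I2) (auto simp: R_def abs_mult intro!: mult_left_le_one_le)
  qed
  have "(\<integral>X. T X * (\<Prod>i\<in>I. h i (X i)) \<partial>R) \<le> (\<integral>X. T X * (\<Prod>i\<in>I. exp (l i (X i))) \<partial>R)"
  proof (rule integral_mono)
    show "integrable R (\<lambda>X. T X * (\<Prod>i\<in>I. h i (X i)))" by (rule TP[OF hi])
    show "integrable R (\<lambda>X. T X * (\<Prod>i\<in>I. exp (l i (X i))))"
      by (rule TP[of "\<lambda>i x. exp (l i x)", OF e(1)])
    show "T X * (\<Prod>i\<in>I. h i (X i)) \<le> T X * (\<Prod>i\<in>I. exp (l i (X i)))" if "X \<in> space R" for X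
      using T(2) that hB by (intro mult_left_mono prod_mono) (auto simp: R_def)
  qed
  also have "\<dots> = (\<integral>X. T X \<partial>density R (\<lambda>X. ennreal (\<Prod>i\<in>I. exp (l i (X i)))))"
  proof -
    have "integrable R (\<lambda>X. \<Prod>i\<in>I. exp (l i (X i)))"
      unfolding R_def by (rule PP.product_integrable_prod[where f="\<lambda>i x. exp (l i x)", OF I(1) e(1)])
    then show ?thesis
      using Tm by (subst integral_density) (auto intro!: prod_nonneg simp: mult.commute)
  qed
  also have "density R (\<lambda>X. ennreal (\<Prod>i\<in>I. exp (l i (X i))))
      = PiM I (\<lambda>i. density Q (\<lambda>x. ennreal (exp (l i x))))"
    unfolding R_def using em P
    by (subst PiM_density[OF I(1) Q]) (auto simp: prod_ennreal)
  finally show ?thesis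
    using invariant_test_product_lower_bound[OF Q I hm hB(1) h2 h_le \<rho> s v T]
    by (simp add: R_def test_error_def)
qed

section \<open>Moments in an exponential family\<close>

lemma convex_natural_parameter_space:
  assumes "sets \<mu> = sets borel"
  shows "convex (natural_parameter_space \<mu>)"
proof (rule convexI)
  fix \<theta> \<eta> and u v :: real
  assume in_\<Theta>: "\<theta> \<in> natural_parameter_space \<mu>" "\<eta> \<in> natural_parameter_space \<mu>"
    and uv: "0 \<le> u" "0 \<le> v" "u + v = 1"
  have [measurable]: "(\<lambda>x. exp (\<zeta> \<bullet> x)) \<in> borel_measurable \<mu>" for \<zeta>
    unfolding measurable_cong_sets[OF assms refl] by measurable
  have "exp ((u *\<^sub>R \<theta> + v *\<^sub>R \<eta>) \<bullet> x) \<le> u * exp (\<theta> \<bullet> x) + v * exp (\<eta> \<bullet> x)" for x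
  proof -
    have "u = 1 - v" using uv by simp
    then show ?thesis
      using convex_onD[OF exp_convex, of v "\<theta> \<bullet> x" "\<eta> \<bullet> x"] uv(1,2) by (simp add: inner_add_left)
  qed
  then have "(\<integral>\<^sup>+x. ennreal (exp ((u *\<^sub>R \<theta> + v *\<^sub>R \<eta>) \<bullet> x)) \<partial>\<mu>)
      \<le> (\<integral>\<^sup>+x. ennreal u * ennreal (exp (\<theta> \<bullet> x)) + ennreal v * ennreal (exp (\<eta> \<bullet> x)) \<partial>\<mu>)"
    using uv by (intro nn_integral_mono) (simp flip: ennreal_mult ennreal_plus)
  also have "\<dots> = ennreal u * (\<integral>\<^sup>+x. ennreal (exp (\<theta> \<bullet> x)) \<partial>\<mu>) + ennreal v * (\<integral>\<^sup>+x. ennreal (exp (\<eta> \<bullet> x)) \<partial>\<mu>)"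
    by (simp add: nn_integral_add nn_integral_cmult)
  also have "\<dots> < \<infinity>"
    using in_\<Theta> by (simp add: natural_parameter_space_def ennreal_mult_less_top)
  finally show "u *\<^sub>R \<theta> + v *\<^sub>R \<eta> \<in> natural_parameter_space \<mu>"
    by (simp add: natural_parameter_space_def)
qed

text \<open>
  Some coordinate of \<open>x\<close> is at least \<open>norm x / D\<close> in absolute value, where \<open>D\<close> is the dimension. Hence
  \<open>exp (\<theta> \<bullet> x + (e / D) * norm x)\<close> is dominated by the sum of \<open>exp (\<eta> \<bullet> x)\<close> over the finitely many points
  \<open>\<eta> = \<theta> \<plusminus> e b\<close> with \<open>b\<close> in the standard basis, which lie in the parameter space for small \<open>e\<close>.
\<close>

lemma exp_norm_nn_integral_finite:
  fixes \<mu> :: "(real^'p) measure"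
  assumes sets: "sets \<mu> = sets borel" and "open (natural_parameter_space \<mu>)"
    and "\<theta> \<in> natural_parameter_space \<mu>"
  obtains s where "s > 0" "(\<integral>\<^sup>+x. ennreal (exp (\<theta> \<bullet> x + s * norm x)) \<partial>\<mu>) < \<infinity>"
proof -
  obtain r where r: "r > 0" "ball \<theta> r \<subseteq> natural_parameter_space \<mu>"
    using assms(2,3) open_contains_ball by blast
  define e where "e = r / 2"
  have e: "e > 0" "e < r" using r by (auto simp: e_def)
  define D where "D = real (DIM(real^'p))"
  have D: "D > 0" by (simp add: D_def)
  have [measurable]: "(\<lambda>x. exp (\<zeta> \<bullet> x)) \<in> borel_measurable \<mu>" for \<zeta>
    unfolding measurable_cong_sets[OF sets refl] by measurable
  have dom: "exp (\<theta> \<bullet> x + (e / D) * norm x) \<le> (\<Sum>b\<in>Basis. exp ((\<theta> + e *\<^sub>R b) \<bullet> x) + exp ((\<theta> - e *\<^sub>R b) \<bullet> x))"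
    for x :: "real^'p"
  proof -
    have "\<exists>b\<in>Basis. norm x \<le> D * \<bar>x \<bullet> b\<bar>"
    proof (rule ccontr)
      assume *: "\<not> (\<exists>b\<in>Basis. norm x \<le> D * \<bar>x \<bullet> b\<bar>)"
      have "\<bar>x \<bullet> b\<bar> < norm x / D" if "b \<in> Basis" for b
        using * that D by (auto simp: field_simps not_le)
      then have "(\<Sum>b\<in>Basis. \<bar>x \<bullet> b\<bar>) < (\<Sum>b\<in>(Basis :: (real^'p) set). norm x / D)"
        by (intro sum_strict_mono) auto
      also have "\<dots> = norm x" using D by (simp add: D_def)
      finally show False using norm_le_l1[of x] by simp
    qed
    then obtain b :: "real^'p" where b: "b \<in> Basis" "norm x \<le> D * \<bar>x \<bullet> b\<bar>"
      by blast
    have "(e / D) * norm x \<le> e * \<bar>x \<bullet> b\<bar>"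
      using b(2) e D by (simp add: field_simps)
    then have "exp (\<theta> \<bullet> x + (e / D) * norm x) \<le> exp (\<theta> \<bullet> x + e * \<bar>x \<bullet> b\<bar>)"
      by simp
    also have "\<dots> \<le> exp ((\<theta> + e *\<^sub>R b) \<bullet> x) + exp ((\<theta> - e *\<^sub>R b) \<bullet> x)"
      by (cases "x \<bullet> b \<ge> 0") (auto simp: inner_add_left inner_diff_left inner_commute[of b])
    also have "\<dots> \<le> (\<Sum>b\<in>Basis. exp ((\<theta> + e *\<^sub>R b) \<bullet> x) + exp ((\<theta> - e *\<^sub>R b) \<bullet> x))"
      using b(1) by (intro member_le_sum) (auto intro: add_nonneg_nonneg)
    finally show ?thesis .
  qed
  have "(\<integral>\<^sup>+x. ennreal (exp (\<theta> \<bullet> x + (e / D) * norm x)) \<partial>\<mu>)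
      \<le> (\<integral>\<^sup>+x. (\<Sum>b\<in>Basis. ennreal (exp ((\<theta> + e *\<^sub>R b) \<bullet> x)) + ennreal (exp ((\<theta> - e *\<^sub>R b) \<bullet> x))) \<partial>\<mu>)"
    using dom by (intro nn_integral_mono) (simp add: sum_nonneg add_nonneg_nonneg ennreal_leI flip: ennreal_plus)
  also have "\<dots> = (\<Sum>b\<in>Basis. (\<integral>\<^sup>+x. ennreal (exp ((\<theta> + e *\<^sub>R b) \<bullet> x)) \<partial>\<mu>)
        + (\<integral>\<^sup>+x. ennreal (exp ((\<theta> - e *\<^sub>R b) \<bullet> x)) \<partial>\<mu>))"
    by (simp add: nn_integral_sum nn_integral_add)
  also have "\<dots> < \<infinity>"
  proof -
    have "\<theta> + e *\<^sub>R b \<in> natural_parameter_space \<mu>" "\<theta> - e *\<^sub>R b \<in> natural_parameter_space \<mu>"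
      if "b \<in> Basis" for b
      using that r(2) e by (auto simp: dist_norm subset_iff)
    then show ?thesis
      by (auto simp: natural_parameter_space_def)
  qed
  finally show thesis
    using that[of "e / D"] e D by simp
qed

text \<open>
  For \<open>\<eta>\<close> within \<open>s / 2\<close> of \<open>\<theta>\<close>, the change from \<open>\<theta>\<close> to \<open>\<eta>\<close> and the polynomial factor cost at most
  \<open>exp (s / 2 * norm x)\<close> each, up to a constant; their product is integrable against \<open>exp (\<theta> \<bullet> x)\<close> by the
  choice of \<open>s\<close>. The normalising constant of \<open>\<eta>\<close> is bounded below by the integral of
  \<open>exp (\<theta> \<bullet> x - s * norm x)\<close>.
\<close>

lemma moment_locally_bounded:
  fixes \<mu> :: "(real^'p) measure"
  assumes sets: "sets \<mu> = sets borel" and op: "open (natural_parameter_space \<mu>)"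
    and nz: "emeasure \<mu> (space \<mu>) \<noteq> 0" and \<theta>: "\<theta> \<in> natural_parameter_space \<mu>"
  obtains e C where "e > 0"
    "\<And>\<eta>. \<eta> \<in> ball \<theta> e \<Longrightarrow> \<eta> \<in> natural_parameter_space \<mu> \<Longrightarrow>
        (\<integral>\<^sup>+x. ennreal ((norm x + 1) ^ 4) \<partial>expfam \<mu> \<eta>) \<le> ennreal C"
proof -
  obtain s where s: "s > 0" "(\<integral>\<^sup>+x. ennreal (exp (\<theta> \<bullet> x + s * norm x)) \<partial>\<mu>) < \<infinity>"
    using exp_norm_nn_integral_finite[OF sets op \<theta>] .
  have m [measurable]: "(\<lambda>x. exp (\<zeta> \<bullet> x)) \<in> borel_measurable \<mu>"
      "(\<lambda>x. exp (\<zeta> \<bullet> x - t)) \<in> borel_measurable \<mu>"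
      "(\<lambda>x. exp (\<zeta> \<bullet> x + t * norm x)) \<in> borel_measurable \<mu>"
      "(\<lambda>x. exp (\<zeta> \<bullet> x - t * norm x)) \<in> borel_measurable \<mu>"
      "(\<lambda>x. (norm x + 1) ^ 4) \<in> borel_measurable \<mu>" for \<zeta> t
    unfolding measurable_cong_sets[OF sets refl] by measurable
  have int: "integrable \<mu> (\<lambda>x. exp (\<eta> \<bullet> x))" if "\<eta> \<in> natural_parameter_space \<mu>" for \<eta>
    using that by (intro integrableI_nonneg) (auto simp: natural_parameter_space_def)
  have int_plus: "integrable \<mu> (\<lambda>x. exp (\<theta> \<bullet> x + s * norm x))"
    using s(2) by (intro integrableI_nonneg) auto
  have int_minus: "integrable \<mu> (\<lambda>x. exp (\<theta> \<bullet> x - s * norm x))"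
    by (rule Bochner_Integration.integrable_bound[OF int[OF \<theta>]]) (use s(1) in auto)
  define J where "J = (\<integral>x. exp (\<theta> \<bullet> x + s * norm x) \<partial>\<mu>)"
  define z where "z = (\<integral>x. exp (\<theta> \<bullet> x - s * norm x) \<partial>\<mu>)"
  have z: "z > 0"
  proof -
    have "z \<noteq> 0"
    proof
      assume "z = 0"
      then have "AE x in \<mu>. exp (\<theta> \<bullet> x - s * norm x) = 0"
        unfolding z_def using int_minus by (subst (asm) integral_nonneg_eq_0_iff_AE) auto
      then have "AE x in \<mu>. False" by simp
      with nz show False by (simp add: AE_iff_null null_sets_def)
    qed
    moreover have "z \<ge> 0" by (simp add: z_def)
    ultimately show ?thesis by simp
  qed
  define C where "C = (1 + 8 / s) ^ 4"
  have C: "(norm x + 1) ^ 4 \<le> C * exp (s / 2 * norm x)" for x :: "real^'p"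
  proof -
    have "norm x + 1 \<le> (1 + 8 / s) * (1 + s / 8 * norm x)"
      using s(1) by (simp add: field_simps)
    also have "\<dots> \<le> (1 + 8 / s) * exp (s / 8 * norm x)"
      using s(1) exp_ge_add_one_self by (intro mult_left_mono) auto
    finally have "(norm x + 1) ^ 4 \<le> ((1 + 8 / s) * exp (s / 8 * norm x)) ^ 4"
      by (intro power_mono) auto
    also have "\<dots> = C * exp (s / 2 * norm x)"
      by (simp add: power_mult_distrib C_def flip: exp_of_nat_mult)
    finally show ?thesis .
  qed
  have "(\<integral>\<^sup>+x. ennreal ((norm x + 1) ^ 4) \<partial>expfam \<mu> \<eta>) \<le> ennreal (C / z * J)"
    if \<eta>: "\<eta> \<in> ball \<theta> (s / 2)" "\<eta> \<in> natural_parameter_space \<mu>" for \<eta>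
  proof -
    have diff: "\<bar>(\<eta> - \<theta>) \<bullet> x\<bar> \<le> s / 2 * norm x" for x
    proof -
      have "norm (\<eta> - \<theta>) \<le> s / 2" using \<eta>(1) by (simp add: dist_norm norm_minus_commute)
      then show ?thesis
        using Cauchy_Schwarz_ineq2[of "\<eta> - \<theta>" x] mult_right_mono[of "norm (\<eta> - \<theta>)" "s / 2" "norm x"] by simp
    qed
    define Z where "Z = (\<integral>x. exp (\<eta> \<bullet> x) \<partial>\<mu>)"
    have "z \<le> Z" unfolding z_def Z_def
    proof (rule integral_mono[OF int_minus int[OF \<eta>(2)]])
      fix x :: "real^'p"
      have "0 \<le> s / 2 * norm x" using s(1) by simp
      then show "exp (\<theta> \<bullet> x - s * norm x) \<le> exp (\<eta> \<bullet> x)"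
        using diff[of x] unfolding inner_diff_left exp_le_cancel_iff by (simp only: abs_le_iff) linarith
    qed
    have bound: "exp (\<eta> \<bullet> x - log_partition \<mu> \<eta>) * (norm x + 1) ^ 4 \<le> C / z * exp (\<theta> \<bullet> x + s * norm x)" for x
    proof -
      have "exp (\<eta> \<bullet> x - log_partition \<mu> \<eta>) = exp (\<eta> \<bullet> x) / Z"
        using z \<open>z \<le> Z\<close> by (simp add: log_partition_def exp_diff flip: Z_def)
      also have "\<dots> \<le> exp (\<eta> \<bullet> x) / z"
        using z \<open>z \<le> Z\<close> by (intro divide_left_mono) auto
      also have "\<dots> \<le> exp (\<theta> \<bullet> x + s / 2 * norm x) / z"
        using z diff[of x]
        by (intro divide_right_mono) (simp_all only: exp_le_cancel_iff inner_diff_left abs_le_iff, linarith+)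
      finally have "exp (\<eta> \<bullet> x - log_partition \<mu> \<eta>) * (norm x + 1) ^ 4
          \<le> (exp (\<theta> \<bullet> x + s / 2 * norm x) / z) * (C * exp (s / 2 * norm x))"
        using C[of x] z by (intro mult_mono) auto
      also have "\<dots> = C / z * (exp (\<theta> \<bullet> x + s / 2 * norm x) * exp (s / 2 * norm x))"
        by simp
      also have "\<dots> = C / z * exp (\<theta> \<bullet> x + s * norm x)"
        by (simp flip: exp_add add: field_simps)
      finally show ?thesis .
    qed
    have "(\<integral>\<^sup>+x. ennreal ((norm x + 1) ^ 4) \<partial>expfam \<mu> \<eta>)
        = (\<integral>\<^sup>+x. ennreal (exp (\<eta> \<bullet> x - log_partition \<mu> \<eta>) * (norm x + 1) ^ 4) \<partial>\<mu>)"
      unfolding expfam_def by (subst nn_integral_density) (auto simp: ennreal_mult)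
    also have "\<dots> \<le> (\<integral>\<^sup>+x. ennreal (C / z * exp (\<theta> \<bullet> x + s * norm x)) \<partial>\<mu>)"
      using bound by (intro nn_integral_mono ennreal_leI) auto
    also have "\<dots> = ennreal (C / z * J)"
      using int_plus z by (subst nn_integral_eq_integral) (auto simp: J_def C_def)
    finally show ?thesis .
  qed
  then show thesis using that[of "s / 2" "C / z * J"] s(1) by simp
qed

lemma moment_uniformly_bounded:
  fixes \<mu> :: "(real^'p) measure"
  assumes "sets \<mu> = sets borel" "open (natural_parameter_space \<mu>)"
    and "emeasure \<mu> (space \<mu>) \<noteq> 0" and K: "compact K" "K \<subseteq> natural_parameter_space \<mu>"
  obtains C where "C \<ge> 1"
    "\<And>\<eta>. \<eta> \<in> K \<Longrightarrow> (\<integral>\<^sup>+x. ennreal ((norm x + 1) ^ 4) \<partial>expfam \<mu> \<eta>) \<le> ennreal C"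
proof -
  have "\<exists>e C. e > 0 \<and> (\<forall>\<eta>\<in>ball \<theta> e \<inter> natural_parameter_space \<mu>.
        (\<integral>\<^sup>+x. ennreal ((norm x + 1) ^ 4) \<partial>expfam \<mu> \<eta>) \<le> ennreal C)"
    if "\<theta> \<in> K" for \<theta>
    using moment_locally_bounded[OF assms(1-3), of \<theta>] that K(2) by (metis IntE subsetD)
  then obtain e C where eC: "\<And>\<theta>. \<theta> \<in> K \<Longrightarrow> e \<theta> > 0"
    "\<And>\<theta> \<eta>. \<theta> \<in> K \<Longrightarrow> \<eta> \<in> ball \<theta> (e \<theta>) \<Longrightarrow> \<eta> \<in> natural_parameter_space \<mu> \<Longrightarrow>
        (\<integral>\<^sup>+x. ennreal ((norm x + 1) ^ 4) \<partial>expfam \<mu> \<eta>) \<le> ennreal (C \<theta>)"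
    by (metis IntI)
  have "K \<subseteq> (\<Union>\<theta>\<in>K. ball \<theta> (e \<theta>))" using eC(1) by force
  then obtain F where F: "F \<subseteq> K" "finite F" "K \<subseteq> (\<Union>\<theta>\<in>F. ball \<theta> (e \<theta>))"
    using compactE_image[OF K(1), of K "\<lambda>\<theta>. ball \<theta> (e \<theta>)"] by auto
  define D where "D = 1 + (\<Sum>\<theta>\<in>F. \<bar>C \<theta>\<bar>)"
  show thesis
  proof (rule that[of D])
    show "D \<ge> 1" by (simp add: D_def sum_nonneg)
    fix \<eta> assume "\<eta> \<in> K"
    then obtain \<theta> where \<theta>: "\<theta> \<in> F" "\<eta> \<in> ball \<theta> (e \<theta>)" using F(3) by blast
    have "(\<integral>\<^sup>+x. ennreal ((norm x + 1) ^ 4) \<partial>expfam \<mu> \<eta>) \<le> ennreal (C \<theta>)"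
      using eC(2) \<theta> F(1) K(2) \<open>\<eta> \<in> K\<close> by blast
    also have "C \<theta> \<le> D"
      using member_le_sum[of \<theta> F "\<lambda>\<theta>. \<bar>C \<theta>\<bar>"] \<theta>(1) F(2) by (simp add: D_def)
    finally show "(\<integral>\<^sup>+x. ennreal ((norm x + 1) ^ 4) \<partial>expfam \<mu> \<eta>) \<le> ennreal D"
      by (auto intro: ennreal_leI order_trans)
  qed
qed

section \<open>Invariant tests in an exponential family\<close>

lemma sets_expfam: "sets \<mu> = sets borel \<Longrightarrow> sets (expfam \<mu> \<theta>) = sets borel"
  by (simp add: expfam_def)

lemma expfam_eq_density_expfam:
  assumes sets: "sets \<mu> = sets borel"
  shows "expfam \<mu> \<eta> = density (expfam \<mu> \<theta>)
    (\<lambda>x. ennreal (exp ((\<eta> - \<theta>) \<bullet> x - (log_partition \<mu> \<eta> - log_partition \<mu> \<theta>))))"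
proof -
  have m: "(\<lambda>x. ennreal (exp (\<zeta> \<bullet> x - t))) \<in> borel_measurable \<mu>" for \<zeta> t
    unfolding measurable_cong_sets[OF sets refl] by measurable
  have "ennreal (exp (\<theta> \<bullet> x - a)) * ennreal (exp ((\<eta> - \<theta>) \<bullet> x - (b - a))) = ennreal (exp (\<eta> \<bullet> x - b))" for x a b
    by (simp add: inner_diff_left flip: ennreal_mult exp_add)
  then show ?thesis
    unfolding expfam_def density_density_eq[OF m m] by simp
qed

text \<open>
  Jensen's inequality for the log-likelihood ratio \<open>l\<close>, which has \<open>exp l\<close> of mean 1. Exchanging \<open>\<theta>\<close> and
  \<open>\<eta>\<close> gives a Lipschitz bound for the log-partition function without differentiating it.
\<close>

lemma log_partition_lower_bound:
  fixes \<mu> :: "(real^'p) measure"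
  assumes sets: "sets \<mu> = sets borel" and nz: "emeasure \<mu> (space \<mu>) \<noteq> 0"
    and \<Theta>: "\<theta> \<in> natural_parameter_space \<mu>" "\<eta> \<in> natural_parameter_space \<mu>"
    and C: "(\<integral>\<^sup>+x. ennreal ((norm x + 1) ^ 4) \<partial>expfam \<mu> \<theta>) \<le> ennreal C" "1 \<le> C"
  shows "log_partition \<mu> \<theta> - log_partition \<mu> \<eta> \<le> C * norm (\<eta> - \<theta>)"
proof -
  interpret P: prob_space "expfam \<mu> \<theta>"
    by (rule prob_space_expfam[OF sets \<Theta>(1) nz])
  define l where "l x = (\<eta> - \<theta>) \<bullet> x - (log_partition \<mu> \<eta> - log_partition \<mu> \<theta>)" for x
  have lm: "l \<in> borel_measurable (expfam \<mu> \<theta>)"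
    unfolding measurable_cong_sets[OF sets_expfam[OF sets] refl] l_def by measurable
  have nm: "(\<lambda>x. (norm x + 1) ^ 4) \<in> borel_measurable (expfam \<mu> \<theta>)"
    unfolding measurable_cong_sets[OF sets_expfam[OF sets] refl] by measurable
  have N: "integrable (expfam \<mu> \<theta>) (\<lambda>x. (norm x + 1) ^ 4)"
    using nm le_less_trans[OF C(1)] by (intro integrableI_nonneg) auto
  have NC: "(\<integral>x. (norm x + 1) ^ 4 \<partial>expfam \<mu> \<theta>) \<le> C"
    using C by (subst (asm) nn_integral_eq_integral[OF N]) auto
  have "(\<integral>\<^sup>+x. ennreal (exp (l x)) \<partial>expfam \<mu> \<theta>) = emeasure (expfam \<mu> \<eta>) (space (expfam \<mu> \<eta>))"
    unfolding expfam_eq_density_expfam[OF sets, of \<eta> \<theta>] l_def[symmetric] using lm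
    by (simp add: emeasure_density cong: nn_integral_cong)
  also have "\<dots> = 1"
    by (rule prob_space.emeasure_space_1[OF prob_space_expfam[OF sets \<Theta>(2) nz]])
  finally have "has_bochner_integral (expfam \<mu> \<theta>) (\<lambda>x. exp (l x)) 1"
    using lm by (intro has_bochner_integral_nn_integral) auto
  then have e: "integrable (expfam \<mu> \<theta>) (\<lambda>x. exp (l x))" "(\<integral>x. exp (l x) \<partial>expfam \<mu> \<theta>) = 1"
    by (auto simp: has_bochner_integral_iff)
  let ?b = "log_partition \<mu> \<eta> - log_partition \<mu> \<theta>"
  have "1 - ?b - norm (\<eta> - \<theta>) * (norm x + 1) ^ 4 \<le> exp (l x)" for x
  proof -
    have "norm x \<le> (norm x + 1) ^ 4"
      using power_increasing[of 1 4 "norm x + 1"] by simp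
    then have "norm (\<eta> - \<theta>) * norm x \<le> norm (\<eta> - \<theta>) * (norm x + 1) ^ 4"
      by (intro mult_left_mono) auto
    then show ?thesis
      using exp_ge_add_one_self[of "l x"] Cauchy_Schwarz_ineq2[of "\<eta> - \<theta>" x]
      unfolding l_def by linarith
  qed
  then have "(\<integral>x. 1 - ?b - norm (\<eta> - \<theta>) * (norm x + 1) ^ 4 \<partial>expfam \<mu> \<theta>) \<le> (\<integral>x. exp (l x) \<partial>expfam \<mu> \<theta>)"
    using N by (intro integral_mono e) auto
  also have "(\<integral>x. 1 - ?b - norm (\<eta> - \<theta>) * (norm x + 1) ^ 4 \<partial>expfam \<mu> \<theta>)
      = 1 - ?b - norm (\<eta> - \<theta>) * (\<integral>x. (norm x + 1) ^ 4 \<partial>expfam \<mu> \<theta>)"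
    using N by (simp add: P.prob_space)
  finally have "- ?b \<le> norm (\<eta> - \<theta>) * (\<integral>x. (norm x + 1) ^ 4 \<partial>expfam \<mu> \<theta>)"
    by (simp add: e)
  also have "\<dots> \<le> norm (\<eta> - \<theta>) * C" using NC by (intro mult_left_mono) auto
  finally show ?thesis by (simp add: mult.commute)
qed

lemma test_error_eventually_small:
  assumes "\<epsilon> > 0" "0 \<le> g * \<tau>"
  obtains B N where "B \<ge> 1" "\<And>n. n \<ge> N \<Longrightarrow> test_error g \<tau> B n \<le> \<epsilon>"
proof -
  \<comment> \<open>At this level the truncation term is at most \<open>\<epsilon>\<^sup>2 / 2\<close>, because \<open>B \<le> B\<^sup>2\<close>; the other half of
    \<open>\<epsilon>\<^sup>2\<close> is left for the term that decays in \<open>n\<close>.\<close>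
  define B where "B = 1 + 4 * (g * \<tau>) / \<epsilon>\<^sup>2"
  have B: "B \<ge> 1" using assms by (simp add: B_def)
  have "4 * (g * \<tau>) \<le> \<epsilon>\<^sup>2 * B" using assms by (simp add: B_def field_simps)
  also have "\<dots> \<le> \<epsilon>\<^sup>2 * B\<^sup>2"
    using B by (intro mult_left_mono self_le_power) auto
  finally have tail: "2 * (g * \<tau> / B\<^sup>2) \<le> \<epsilon>\<^sup>2 / 2"
    using B by (simp add: field_simps)
  define E where "E = exp (exp (2 * B) * g * \<tau>)"
  define c where "c = 2 * (exp (2 * B) * g * \<tau>)\<^sup>2 + (exp (2 * B) * \<tau>\<^sup>2 * (18 * g\<^sup>2 + 8 * g))\<^sup>2"
  define k where "k = \<epsilon>\<^sup>2 / 2 / E"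
  have k: "k > 0" using assms by (simp add: k_def E_def)
  obtain N0 :: nat where N0: "c / k\<^sup>2 < N0" using reals_Archimedean2 by blast
  have "test_error g \<tau> B n \<le> \<epsilon>" if "n \<ge> N0 + 2" for n
  proof -
    have "c / k\<^sup>2 \<le> real (n - 1)" using N0 that by linarith
    then have "c / real (n - 1) \<le> k\<^sup>2"
      using k that by (simp add: field_simps)
    then have "sqrt (c / real (n - 1)) \<le> k" using k by (intro real_le_lsqrt) (auto simp: c_def)
    then have "E * sqrt (c / real (n - 1)) \<le> E * k" by (intro mult_left_mono) (auto simp: E_def)
    also have "\<dots> = \<epsilon>\<^sup>2 / 2" by (simp add: k_def E_def)
    finally have "E * sqrt (c / real (n - 1)) + 2 * (g * \<tau> / B\<^sup>2) \<le> \<epsilon>\<^sup>2"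
      using tail by simp
    then have "test_error g \<tau> B n \<le> sqrt (\<epsilon>\<^sup>2)"
      unfolding test_error_def E_def[symmetric] c_def[symmetric] by (rule real_sqrt_le_mono)
    then show ?thesis using assms(1) by simp
  qed
  with B show thesis by (rule that)
qed

lemma row_mean_in_convex:
  assumes "convex K" "\<And>i. i < n \<Longrightarrow> m i \<in> K" "n > 0"
  shows "row_mean n m \<in> K"
proof -
  have "row_mean n m = (\<Sum>i<n. (1 / real n) *\<^sub>R m i)"
    by (simp add: row_mean_def scaleR_right.sum inverse_eq_divide)
  also have "\<dots> \<in> K"
    using assms by (intro convex_sum) auto
  finally show ?thesis .
qed

text \<open>
  With \<open>q\<close> the mean of the parameters, the log-likelihood ratio of row \<open>i\<close> is \<open>(m i - q) \<bullet> x\<close> minus a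
  constant. Its modulus is at most \<open>norm (m i - q) * W x\<close> for one envelope \<open>W\<close>, and the sum over all rows does
  not depend on \<open>x\<close> because the deviations \<open>m i - q\<close> add up to 0.
\<close>

lemma expfam_test_lower_bound:
  fixes \<mu> :: "(real^'p) measure"
  assumes sets: "sets \<mu> = sets borel" and nz: "emeasure \<mu> (space \<mu>) \<noteq> 0"
    and K: "convex K" "K \<subseteq> natural_parameter_space \<mu>"
    and C: "C \<ge> 1" "\<And>\<eta>. \<eta> \<in> K \<Longrightarrow> (\<integral>\<^sup>+x. ennreal ((norm x + 1) ^ 4) \<partial>expfam \<mu> \<eta>) \<le> ennreal C"
    and m: "\<And>i. i < n \<Longrightarrow> m i \<in> K" and n: "n \<ge> 2"
    and \<delta>: "mat_norm n (\<lambda>i. m i - mean_matrix n m i) \<le> \<delta>"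
    and T: "T \<in> invariant_tests n" and B: "B \<ge> 1"
  shows "(\<integral>X. T X \<partial>data_law \<mu> n (mean_matrix n m)) - test_error (C ^ 5) (\<delta>\<^sup>2) B n
      \<le> (\<integral>X. T X \<partial>data_law \<mu> n m)"
proof -
  define q where "q = row_mean n m"
  have qK: "q \<in> K"
    unfolding q_def using n by (intro row_mean_in_convex K(1) m) auto
  define Q where "Q = expfam \<mu> q"
  define l where "l i x = (m i - q) \<bullet> x - (log_partition \<mu> (m i) - log_partition \<mu> q)" for i x
  \<comment> \<open>The envelope absorbs both \<open>norm x\<close> and the Lipschitz constant \<open>C\<close> of the log-partition function;
    \<open>W \<ge> 1\<close> makes the second moment of \<open>W\<close> at most the fourth, which is at most \<open>C ^ 4 * C\<close>.\<close>
  define W where "W x = C * (norm x + 1)" for x :: "real^'p"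
  have sQ: "sets Q = sets borel" by (simp add: Q_def sets_expfam[OF sets])
  have spQ: "space Q = UNIV" using sets_eq_imp_space_eq[OF sQ] by simp
  have ps: "prob_space (expfam \<mu> \<eta>)" if "\<eta> \<in> K" for \<eta>
    using prob_space_expfam[OF sets _ nz] that K(2) by blast
  have dens: "density Q (\<lambda>x. ennreal (exp (l i x))) = expfam \<mu> (m i)" for i
    unfolding Q_def l_def by (rule expfam_eq_density_expfam[OF sets, symmetric])
  have bm: "f \<in> borel_measurable (expfam \<mu> \<eta>)" if "f \<in> borel_measurable borel" for f :: "real^'p \<Rightarrow> real" and \<eta>
    using that unfolding measurable_cong_sets[OF sets_expfam[OF sets] refl] .
  have W1: "1 \<le> W x" for x
    using C(1) mult_mono[of 1 C 1 "norm x + 1"] by (simp add: W_def)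
  have W4: "(\<integral>\<^sup>+x. ennreal ((W x) ^ 4) \<partial>expfam \<mu> \<eta>) \<le> ennreal (C ^ 5)" if "\<eta> \<in> K" for \<eta>
  proof -
    have "(\<integral>\<^sup>+x. ennreal ((W x) ^ 4) \<partial>expfam \<mu> \<eta>) = (\<integral>\<^sup>+x. ennreal (C ^ 4) * ennreal ((norm x + 1) ^ 4) \<partial>expfam \<mu> \<eta>)"
      using C(1) by (simp add: W_def power_mult_distrib flip: ennreal_mult)
    also have "\<dots> = ennreal (C ^ 4) * (\<integral>\<^sup>+x. ennreal ((norm x + 1) ^ 4) \<partial>expfam \<mu> \<eta>)"
      by (intro nn_integral_cmult measurable_compose[OF _ measurable_ennreal] bm) measurable
    also have "\<dots> \<le> ennreal (C ^ 4) * ennreal C"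
      by (intro mult_left_mono C(2) that) auto
    also have "\<dots> = ennreal (C ^ 5)"
      using C(1) by (simp add: power_Suc2[of C 4, simplified] flip: ennreal_mult)
    finally show ?thesis .
  qed
  have W24: "(W x)\<^sup>2 \<le> (W x) ^ 4" for x
    by (rule power_increasing[OF _ W1]) simp
  have W2: "(\<integral>\<^sup>+x. ennreal ((W x)\<^sup>2) \<partial>expfam \<mu> \<eta>) \<le> ennreal (C ^ 5)" if "\<eta> \<in> K" for \<eta>
    by (rule order_trans[OF nn_integral_mono W4[OF that]]) (simp add: W24 ennreal_leI)
  have fin: "integrable Q f \<and> (\<integral>x. f x \<partial>Q) \<le> C ^ 5"
    if "f \<in> borel_measurable borel" "\<And>x. 0 \<le> f x" "(\<integral>\<^sup>+x. ennreal (f x) \<partial>Q) \<le> ennreal (C ^ 5)" for f :: "real^'p \<Rightarrow> real"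
  proof -
    have i: "integrable Q f"
      using bm[OF that(1)] that(2) le_less_trans[OF that(3)] by (intro integrableI_nonneg) (auto simp: Q_def)
    then show ?thesis
      using that(2,3) C(1) by (subst (asm) nn_integral_eq_integral[OF i]) auto
  qed
  have Wm: "W \<in> borel_measurable borel" unfolding W_def by measurable
  have Wm': "(\<lambda>x. (W x) ^ 4) \<in> borel_measurable borel" "(\<lambda>x. (W x)\<^sup>2) \<in> borel_measurable borel"
    unfolding W_def by measurable
  have l_le: "\<bar>l i x\<bar> \<le> norm (m i - q) * W x" if "i \<in> {..<n}" for i x
  proof -
    have mi: "m i \<in> K" using m that by simp
    have "log_partition \<mu> q - log_partition \<mu> (m i) \<le> C * norm (m i - q)"
      using qK mi K(2) C by (intro log_partition_lower_bound[OF sets nz]) auto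
    moreover have "log_partition \<mu> (m i) - log_partition \<mu> q \<le> C * norm (q - m i)"
      using qK mi K(2) C by (intro log_partition_lower_bound[OF sets nz]) auto
    ultimately have "\<bar>l i x\<bar> \<le> norm (m i - q) * norm x + C * norm (m i - q)"
      using Cauchy_Schwarz_ineq2[of "m i - q" x] unfolding l_def norm_minus_commute[of q] by linarith
    also have "\<dots> = norm (m i - q) * (norm x + C)" by (simp add: algebra_simps)
    also have "\<dots> \<le> norm (m i - q) * W x"
      using C(1) mult_right_mono[of 1 C "norm x"] by (intro mult_left_mono) (auto simp: W_def algebra_simps)
    finally show ?thesis .
  qed
  have l_const: "(\<Sum>i<n. l i x) = (\<Sum>i<n. log_partition \<mu> q - log_partition \<mu> (m i))" for x
  proof -
    have "(\<Sum>i<n. m i - q) = 0"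
      using n by (simp add: sum_subtractf q_def row_mean_def sum_constant_scaleR del: sum_constant)
    then have "(\<Sum>i<n. (m i - q) \<bullet> x) = 0"
      by (metis inner_sum_left inner_zero_left)
    then show ?thesis by (simp add: l_def sum_subtractf)
  qed
  have \<tau>: "(\<Sum>i<n. (norm (m i - q))\<^sup>2) \<le> \<delta>\<^sup>2"
  proof -
    have "0 \<le> mat_norm n (\<lambda>i. m i - mean_matrix n m i)"
      by (simp add: mat_norm_def trace_def gram_def sum_nonneg)
    then have "(mat_norm n (\<lambda>i. m i - mean_matrix n m i))\<^sup>2 \<le> \<delta>\<^sup>2"
      using \<delta> by (intro power_mono) auto
    then show ?thesis by (simp add: mat_norm_power2 mean_matrix_def q_def)
  qed
  have sPi: "sets (PiM {..<n} (\<lambda>_. Q)) = sets (PiM {..<n} (\<lambda>_. borel))"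
    by (intro sets_PiM_cong refl sQ)
  have spPi: "space (PiM {..<n} (\<lambda>_. Q)) = space (PiM {..<n} (\<lambda>_. borel))"
    by (rule sets_eq_imp_space_eq[OF sPi])
  have "(\<integral>X. T X \<partial>PiM {..<n} (\<lambda>_. Q)) - test_error (C ^ 5) (\<delta>\<^sup>2) B (card {..<n})
      \<le> (\<integral>X. T X \<partial>PiM {..<n} (\<lambda>i. density Q (\<lambda>x. ennreal (exp (l i x)))))"
  proof (rule product_likelihood_test_lower_bound[where W=W and t="\<lambda>i. norm (m i - q)", OF _ _ _ _ _ l_const l_le \<tau> _ _ _ _ _ _ B])
    show "prob_space Q" unfolding Q_def by (rule ps[OF qK])
    show "l i \<in> borel_measurable Q" for i
      unfolding Q_def l_def by (rule bm) measurable
    show "prob_space (density Q (\<lambda>x. ennreal (exp (l i x))))" if "i \<in> {..<n}" for i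
      unfolding dens using that by (intro ps m) auto
    show "W \<in> borel_measurable Q" unfolding Q_def by (rule bm[OF Wm])
    show "integrable Q (\<lambda>x. (W x) ^ 4)" "(\<integral>x. (W x) ^ 4 \<partial>Q) \<le> C ^ 5"
      using fin[OF Wm'(1)] W4[OF qK] by (auto simp: Q_def)
    show "integrable Q (\<lambda>x. (W x)\<^sup>2)" "(\<integral>x. (W x)\<^sup>2 \<partial>Q) \<le> C ^ 5"
      using fin[OF Wm'(2)] W2[OF qK] by (auto simp: Q_def)
    show "(\<integral>\<^sup>+x. ennreal ((W x)\<^sup>2) \<partial>density Q (\<lambda>x. ennreal (exp (l i x)))) \<le> ennreal (C ^ 5)"
      if "i \<in> {..<n}" for i
      unfolding dens using that by (intro W2 m) auto
    show "T \<in> borel_measurable (PiM {..<n} (\<lambda>_. Q))"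
      using T unfolding measurable_cong_sets[OF sPi refl] by (simp add: invariant_tests_def)
  qed (use n T in \<open>auto simp: invariant_tests_def spPi\<close>)
  moreover have "data_law \<mu> n (mean_matrix n m) = PiM {..<n} (\<lambda>_. Q)"
    by (simp add: data_law_def mean_matrix_def Q_def q_def)
  moreover have "data_law \<mu> n m = PiM {..<n} (\<lambda>i. density Q (\<lambda>x. ennreal (exp (l i x))))"
    by (simp add: data_law_def dens)
  ultimately show ?thesis by simp
qed

lemma integral_complementary_test:
  fixes \<mu> :: "(real^'p) measure" and T :: "(nat \<Rightarrow> real^'p) \<Rightarrow> real"
  assumes sets: "sets \<mu> = sets borel" and P: "\<And>i. i < n \<Longrightarrow> prob_space (expfam \<mu> (m i))"
    and T: "T \<in> invariant_tests n"
  shows "(\<integral>X. 1 - T X \<partial>data_law \<mu> n m) = 1 - (\<integral>X. T X \<partial>data_law \<mu> n m)"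
proof -
  interpret prob_space "data_law \<mu> n m"
    unfolding data_law_def using P by (intro prob_space_PiM) auto
  have s: "sets (data_law \<mu> n m) = sets (PiM {..<n} (\<lambda>_. borel))"
    unfolding data_law_def by (intro sets_PiM_cong refl sets_expfam[OF sets])
  have "integrable (data_law \<mu> n m) T"
    using T sets_eq_imp_space_eq[OF s]
    by (intro integrable_const_bound[where B=1])
      (auto simp: invariant_tests_def measurable_cong_sets[OF s refl])
  then show ?thesis by (simp add: prob_space)
qed

lemma invariant_tests_complement:
  assumes "T \<in> invariant_tests n"
  shows "(\<lambda>X. 1 - T X) \<in> invariant_tests n"
  using assms by (auto simp: invariant_tests_def)

text \<open>
  For the zero measure the densities cannot be normalised, but then all members of the family coincide.
\<close>

lemma expfam_null_measure:
  assumes "sets \<mu> = sets borel" "emeasure \<mu> (space \<mu>) = 0"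
  shows "expfam \<mu> \<eta> = expfam \<mu> \<theta>"
proof -
  have "emeasure (expfam \<mu> \<zeta>) A = 0" for \<zeta> A
  proof -
    have [measurable]: "(\<lambda>x. exp (\<zeta> \<bullet> x - log_partition \<mu> \<zeta>)) \<in> borel_measurable \<mu>"
      unfolding measurable_cong_sets[OF assms(1) refl] by measurable
    have "emeasure (expfam \<mu> \<zeta>) (space \<mu>) = 0"
      unfolding expfam_def using assms(2)
      by (simp add: emeasure_density AE_iff_null null_sets_def nn_integral_0_iff_AE)
    then show ?thesis
      using emeasure_space[of "expfam \<mu> \<zeta>" A] by (simp add: expfam_def)
  qed
  then show ?thesis by (intro measure_eqI) (simp_all add: expfam_def)
qed

theorem theorem6:
  fixes \<mu> :: "(real^'p) measure" and \<Theta>\<^sub>0 :: "(real^'p) set" and \<delta> :: real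
  assumes "sets \<mu> = sets borel"
    and "open (natural_parameter_space \<mu>)"
    and "compact \<Theta>\<^sub>0"
    and "\<Theta>\<^sub>0 \<subseteq> natural_parameter_space \<mu>"
    and "\<delta> > 0"
  shows "(\<lambda>n. Sup {ennreal \<bar>(\<integral>X. T X \<partial>data_law \<mu> n m) - (\<integral>X. T X \<partial>data_law \<mu> n (mean_matrix n m))\<bar>
            | m T. T \<in> invariant_tests n \<and>
                   mat_norm n (\<lambda>i. m i - mean_matrix n m i) \<le> \<delta> \<and>
                   (\<forall>i<n. m i \<in> \<Theta>\<^sub>0)})
         \<longlonglongrightarrow> 0"
    (is "?S \<longlonglongrightarrow> 0")
proof (cases "emeasure \<mu> (space \<mu>) = 0")
  case True
  have "data_law \<mu> n m = data_law \<mu> n m'" for n m m'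
    unfolding data_law_def using expfam_null_measure[OF assms(1) True] by (intro PiM_cong) auto
  then have "?S n \<le> 0" for n
  proof (intro Sup_least, clarify)
    fix m :: "nat \<Rightarrow> real^'p" and T
    have "data_law \<mu> n m = data_law \<mu> n (mean_matrix n m)" by fact
    then show "ennreal \<bar>(\<integral>X. T X \<partial>data_law \<mu> n m) - (\<integral>X. T X \<partial>data_law \<mu> n (mean_matrix n m))\<bar> \<le> 0"
      by simp
  qed
  then have "?S = (\<lambda>_. 0)" by (intro ext) simp
  then show ?thesis by simp
next
  case nz: False
  define K where "K = convex hull \<Theta>\<^sub>0"
  have K: "compact K" "convex K" "K \<subseteq> natural_parameter_space \<mu>" "\<Theta>\<^sub>0 \<subseteq> K"
    unfolding K_def
    by (rule compact_convex_hull[OF assms(3)] convex_convex_hull hull_subset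
        hull_minimal[of \<Theta>\<^sub>0 "natural_parameter_space \<mu>" convex,
          OF assms(4) convex_natural_parameter_space[OF assms(1)]])+
  obtain C where C: "C \<ge> 1"
    "\<And>\<eta>. \<eta> \<in> K \<Longrightarrow> (\<integral>\<^sup>+x. ennreal ((norm x + 1) ^ 4) \<partial>expfam \<mu> \<eta>) \<le> ennreal C"
    using moment_uniformly_bounded[OF assms(1,2) nz K(1,3)] by blast
  show ?thesis
  proof (rule order_tendstoI)
    fix a :: ennreal assume "0 < a"
    then obtain b where b: "0 < b" "b < a" using dense by blast
    then obtain \<epsilon> where \<epsilon>: "b = ennreal \<epsilon>" "\<epsilon> > 0"
      by (cases b) (auto simp: ennreal_less_zero_iff top_unique)
    obtain B N where BN: "B \<ge> 1" "\<And>n. n \<ge> N \<Longrightarrow> test_error (C ^ 5) (\<delta>\<^sup>2) B n \<le> \<epsilon>"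
      using test_error_eventually_small[of \<epsilon> "C ^ 5" "\<delta>\<^sup>2"] \<epsilon>(2) C(1) by auto
    have "?S n \<le> b" if n: "n \<ge> max N 2" for n
    proof (rule Sup_least, clarify)
      fix m :: "nat \<Rightarrow> real^'p" and T :: "(nat \<Rightarrow> real^'p) \<Rightarrow> real"
      assume T: "T \<in> invariant_tests n" and \<delta>: "mat_norm n (\<lambda>i. m i - mean_matrix n m i) \<le> \<delta>"
        and "\<forall>i<n. m i \<in> \<Theta>\<^sub>0"
      then have mK: "\<And>i. i < n \<Longrightarrow> m i \<in> K" using K(4) by auto
      have qK: "mean_matrix n m i \<in> K" for i
        unfolding mean_matrix_def using n by (intro row_mean_in_convex K(2) mK) auto
      have P: "prob_space (expfam \<mu> \<eta>)" if "\<eta> \<in> K" for \<eta>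
        using prob_space_expfam[OF assms(1) _ nz] K(3) that by blast
      have low: "(\<integral>X. U X \<partial>data_law \<mu> n (mean_matrix n m)) - \<epsilon> \<le> (\<integral>X. U X \<partial>data_law \<mu> n m)"
        if "U \<in> invariant_tests n" for U
        using expfam_test_lower_bound[OF assms(1) nz K(2,3) C mK _ \<delta> that BN(1)] BN(2)[of n] n by simp
      have "(\<integral>X. 1 - T X \<partial>data_law \<mu> n m) = 1 - (\<integral>X. T X \<partial>data_law \<mu> n m)"
        "(\<integral>X. 1 - T X \<partial>data_law \<mu> n (mean_matrix n m)) = 1 - (\<integral>X. T X \<partial>data_law \<mu> n (mean_matrix n m))"
        by (rule integral_complementary_test[OF assms(1) P[OF mK] T],
            assumption, rule integral_complementary_test[OF assms(1) P[OF qK] T])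
      \<comment> \<open>A lower bound for the complementary test \<open>1 - T\<close> is an upper bound for \<open>T\<close>.\<close>
      then have "\<bar>(\<integral>X. T X \<partial>data_law \<mu> n m) - (\<integral>X. T X \<partial>data_law \<mu> n (mean_matrix n m))\<bar> \<le> \<epsilon>"
        using low[OF T] low[OF invariant_tests_complement[OF T]] by linarith
      then show "ennreal \<bar>(\<integral>X. T X \<partial>data_law \<mu> n m) - (\<integral>X. T X \<partial>data_law \<mu> n (mean_matrix n m))\<bar> \<le> b"
        unfolding \<epsilon>(1) by (rule ennreal_leI)
    qed
    then have "\<forall>n\<ge>max N 2. ?S n < a" using b(2) by (meson le_less_trans)
    then show "\<forall>\<^sub>F n in sequentially. ?S n < a"
      unfolding eventually_sequentially by blast
  qed simp
qed

end
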